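(* Let $q=1+3a^2$ be a prime power, with $a$ an integer, such that $2$ is a cubic residue in $\mathbb{F}_q$. Let $\gamma$ be a primitive element of $\mathbb{F}_q$, $l=\frac{q-1}{6}$, and let $G$ be the group on $\mathbb{F}_q\times\mathbb{Z}_l$ with multiplication $(x,i)(y,j)=(x+\gamma^{6i}y,\ i+j)$. Let $S=\{-1+x: x\in D_3^6\}$ and $E=\{(x,i): x\in S,\ i\in\mathbb{Z}_l\}$. Then $\mathrm{Cay}(G,E)$ is a directed strongly regular graph with parameters $\left(\frac{q(q-1)}{6},\ \left(\frac{q-1}{6}\right)^2,\ \frac{(q-1)^2}{216},\ \frac{(q-1)^2}{216}-\frac{q-1}{36},\ \frac{(q-1)^2}{216}\right)$.
   Context: The cyclotomic classes of order $e$ (for $e\mid q-1$) with respect to $\gamma$ are $D_i^e=\gamma^i\langle\gamma^e\rangle$, $i=0,\dots,e-1$. "2 is a cubic residue" means $2=z^3$ for some $z\in\mathbb{F}_q^*$. The Cayley digraph $\mathrm{Cay}(G,E)$ has vertex set $G$ and an arc $g\to h$ iff $g^{-1}h\in E$. A directed strongly regular graph with parameters $(v,k,t,\lambda,\mu)$ is a digraph (no loops, no multiple arcs) on $v$ vertices whose adjacency matrix $A$ satisfies $A^2=tI+\lambda A+\mu(J-I-A)$ and $AJ=JA=kJ$. *)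

theory Defs
  imports Complex_Main
begin

definition primitive_elem :: "'a::{finite,field} \<Rightarrow> bool" where
  "primitive_elem \<gamma> \<longleftrightarrow> \<gamma> \<noteq> 0 \<and> (\<forall>x. x \<noteq> 0 \<longrightarrow> (\<exists>k::nat. x = \<gamma> ^ k))"

definition cyclo_class :: "'a::field \<Rightarrow> nat \<Rightarrow> nat \<Rightarrow> 'a set" where
  "cyclo_class \<gamma> e i = {\<gamma> ^ (i + e * k) | k. True}"

definition Gcar :: "nat \<Rightarrow> ('a \<times> nat) set" where
  "Gcar l = {(x, i). i < l}"

definition Gmult :: "'a::field \<Rightarrow> nat \<Rightarrow> 'a \<times> nat \<Rightarrow> 'a \<times> nat \<Rightarrow> 'a \<times> nat" where
  "Gmult \<gamma> l g h = (fst g + \<gamma> ^ (6 * snd g) * fst h, (snd g + snd h) mod l)"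

definition Ginv :: "'a::field \<Rightarrow> nat \<Rightarrow> 'a \<times> nat \<Rightarrow> 'a \<times> nat" where
  "Ginv \<gamma> l g = (- inverse (\<gamma> ^ (6 * snd g)) * fst g, (l - snd g) mod l)"

definition cay_arc :: "'a::field \<Rightarrow> nat \<Rightarrow> ('a \<times> nat) set \<Rightarrow> 'a \<times> nat \<Rightarrow> 'a \<times> nat \<Rightarrow> bool" where
  "cay_arc \<gamma> l E g h \<longleftrightarrow> Gmult \<gamma> l (Ginv \<gamma> l g) h \<in> E"

text \<open>Directed strongly regular graph with parameters (v,k,t,lambda,mu) on vertex set V
  with arc relation adj: no loops, |V| = v, every in- and out-degree is k (AJ = JA = kJ),
  and the number of 2-paths x -> z -> y equals the (x,y)-entry of
  tI + lambda A + mu (J - I - A), i.e. the (x,y) entry of A^2.\<close>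
definition dsrg :: "'v set \<Rightarrow> ('v \<Rightarrow> 'v \<Rightarrow> bool) \<Rightarrow> real \<Rightarrow> real \<Rightarrow> real \<Rightarrow> real \<Rightarrow> real \<Rightarrow> bool" where
  "dsrg V adj v k t lam mu \<longleftrightarrow>
     finite V \<and> real (card V) = v \<and>
     (\<forall>x\<in>V. \<not> adj x x) \<and>
     (\<forall>x\<in>V. real (card {y\<in>V. adj x y}) = k) \<and>
     (\<forall>x\<in>V. real (card {y\<in>V. adj y x}) = k) \<and>
     (\<forall>x\<in>V. \<forall>y\<in>V. real (card {z\<in>V. adj x z \<and> adj z y}) =
        (if x = y then t else if adj x y then lam else mu))"

end

theory Submission
  imports Defs "HOL-Algebra.Sylow" "HOL-Algebra.Multiplicative_Group" "HOL-Number_Theory.Number_Theory"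
begin

text \<open>Since \<open>- 1\<close> lies in \<open>D\<^sub>0\<close>, there is an arc from \<open>(x, i)\<close> to \<open>(y, j)\<close> iff
  \<open>y - x + \<gamma> ^ (6 i) \<in> D\<^sub>3\<close>, and everything reduces to the claim that every nonzero element is
  a difference \<open>v - u\<close> with \<open>v \<in> D\<^sub>3\<close>, \<open>u \<in> D\<^sub>0\<close> in exactly \<open>l / 6\<close> ways.
  By scaling and inversion this means that \<open>1 + D\<^sub>3\<close> is equidistributed over the cubic
  classes, i.e. the sum of \<open>\<psi> (1 + v)\<close> over \<open>v \<in> D\<^sub>3\<close> vanishes for a cubic character \<open>\<psi>\<close>.
  Expanding the indicator of \<open>D\<^sub>3\<close> in characters of order 6, and using that 2 is a cube, the sum
  is a multiple of \<open>1 + Re J\<close> with \<open>J = J(\<psi>, \<psi>)\<close>.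

  Symmetries of \<open>x (1 - x)\<close> of order 2 and 3 show \<open>J = L + M sqrt(-3)\<close> with integers
  \<open>L \<equiv> - 1\<close> and \<open>M \<equiv> 0\<close> modulo 3. Moreover \<open>L\<^sup>2 + 3 M\<^sup>2 = q = 1 + 3 a\<^sup>2\<close>, and the
  characteristic \<open>p\<close> does not divide \<open>J\<close>, because a power sum in the field equals, up to
  sign, a central binomial coefficient that is prime to \<open>p\<close>. Unique representation of the prime
  power \<open>q\<close> then gives \<open>L = - 1\<close>.\<close>

section \<open>Arithmetic of the norm form\<close>

text \<open>The prime \<open>p\<close> divides at most one of \<open>a * L - M\<close> and
  \<open>a * L + M\<close>, whose product is a multiple of \<open>q\<close>, so all of
  \<open>q\<close> divides one of them. The composition identity for \<open>x^2 + 3 y^2\<close> then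
  forces that factor to be 0, whence \<open>M = a * L\<close> up to sign and
  \<open>q = L^2 * q\<close>.\<close>

lemma norm_form_unique:
  fixes a L M :: int and p f :: nat
  assumes p: "prime p" "odd p"
    and qa: "int (p ^ f) = 1 + 3 * a\<^sup>2"
    and qL: "int (p ^ f) = L\<^sup>2 + 3 * M\<^sup>2"
    and f: "f > 0"
    and ndvd: "\<not> (int p dvd L \<and> int p dvd M)"
  shows "L\<^sup>2 = 1"
proof -
  define q where "q = int (p ^ f)"
  have q: "q = 1 + 3 * a\<^sup>2" "q = L\<^sup>2 + 3 * M\<^sup>2" "q > 0"
    by (simp_all add: q_def prime_gt_0_nat[OF p(1)] flip: qa qL)
  have pq: "int p dvd q" using f by (auto simp: q_def)
  have prod: "(a * L - M) * (a * L + M) = q * (a\<^sup>2 - M\<^sup>2)"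
    using q(1,2) by Groebner_Basis.algebra
  have pp: "prime (int p)" using p by simp
  have ndvd_a: "\<not> int p dvd a"
  proof
    assume "int p dvd a"
    hence "int p dvd q - 3 * a\<^sup>2" using pq by (simp add: power2_eq_square)
    hence "int p dvd 1" using q(1) by simp
    thus False using pp by (meson not_prime_unit)
  qed
  have ndvd2: "\<not> int p dvd 2"
    using p primes_dvd_imp_eq[OF p(1) two_is_prime_nat] by (metis even_numeral int_dvd_int_iff of_nat_numeral)
  have one: "\<not> (int p dvd a * L - M \<and> int p dvd a * L + M)"
  proof
    assume *: "int p dvd a * L - M \<and> int p dvd a * L + M"
    have "int p dvd (a * L + M) - (a * L - M)" using * by (blast intro: dvd_diff)
    hence "int p dvd 2 * M" by simp
    hence M: "int p dvd M" using pp ndvd2 by (simp add: prime_dvd_mult_iff)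
    have "int p dvd (a * L - M) + M" using * M by (blast intro: dvd_add)
    hence "int p dvd a * L" by simp
    hence "int p dvd L" using pp ndvd_a by (simp add: prime_dvd_mult_iff)
    thus False using M ndvd by blast
  qed
  have main: "L\<^sup>2 = 1" if d: "q dvd a * L - M'" and M': "M'\<^sup>2 = M\<^sup>2" for M'
  proof -
    obtain k where k: "a * L - M' = q * k" using d by auto
    \<comment> \<open>Composition of the two representations of \<open>q\<close>. Once
      \<open>q\<close> divides the second square root, a nonzero quotient \<open>k\<close> would
      make the right-hand side at least \<open>3 * q * q\<close>.\<close>
    have "q * q = (L + 3 * a * M')\<^sup>2 + 3 * (a * L - M')\<^sup>2"
      using q(1,2) M' by Groebner_Basis.algebra
    hence e: "q * q = (L + 3 * a * M')\<^sup>2 + 3 * (q * k)\<^sup>2" using k by simp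
    have "k = 0"
    proof (rule ccontr)
      assume "k \<noteq> 0"
      hence "k\<^sup>2 \<ge> 1" by (smt (verit) zero_less_power2)
      hence "q * q * 1 \<le> q * q * k\<^sup>2" using q(3) by (intro mult_left_mono) auto
      moreover have "(q * k)\<^sup>2 = q * q * k\<^sup>2" by (simp add: power2_eq_square)
      moreover have "q * q > 0" using q(3) by simp
      ultimately show False using e zero_le_power2[of "L + 3 * a * M'"] by linarith
    qed
    hence "M' = a * L" using k by simp
    hence "q = L\<^sup>2 * q" using q(1,2) M' by Groebner_Basis.algebra
    thus ?thesis using q(3) by simp
  qed
  have dvd: "q dvd (a * L - M) * (a * L + M)" using prod by simp
  show ?thesis
  proof (cases "int p dvd a * L - M")
    case True
    hence "coprime (int p) (a * L + M)" using one pp by (simp add: prime_imp_coprime)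
    hence "coprime q (a * L + M)" by (simp add: q_def)
    hence "q dvd a * L - M" using dvd by (simp add: coprime_dvd_mult_left_iff)
    thus ?thesis using main by blast
  next
    case False
    hence "coprime (int p) (a * L - M)" using pp by (simp add: prime_imp_coprime)
    hence "coprime q (a * L - M)" by (simp add: q_def)
    hence "q dvd a * L - (- M)" using dvd by (simp add: coprime_dvd_mult_right_iff)
    thus ?thesis using main[of "-M"] by simp
  qed
qed

text \<open>Modulo \<open>p\<close> the square of \<open>3 * a\<close> is \<open>- 3\<close>, so
  half of \<open>3 * a - 1\<close> is a root of \<open>x^2 + x + 1\<close>. This root has
  multiplicative order 3, and Fermat's theorem then excludes \<open>p mod 3 = 2\<close>.\<close>

lemma prime_dvd_norm_form_mod_3:
  fixes a :: int and p :: nat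
  assumes p: "prime p" "odd p" and a: "even a" and dvd: "int p dvd 1 + 3 * a\<^sup>2"
  shows "p mod 3 = 1"
proof -
  have pp: "prime (int p)" using p by simp
  \<comment> \<open>As \<open>a\<close> is even, \<open>3 * a - 1\<close> is odd; adding the odd
    \<open>p\<close> allows the halving over the integers.\<close>
  have "even (3 * a - 1 + int p)" using a p by simp
  then obtain x where x: "3 * a - 1 + int p = 2 * x" by (elim evenE)
  have ndvd2: "\<not> int p dvd 2"
    using p primes_dvd_imp_eq[OF p(1) two_is_prime_nat] by (metis even_numeral int_dvd_int_iff of_nat_numeral)
  have ndvd3: "\<not> int p dvd 3"
  proof
    assume 3: "int p dvd 3"
    hence "int p dvd 3 * a\<^sup>2" by simp
    with dvd have "int p dvd 1" by (simp add: dvd_add_left_iff)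
    thus False using pp by (meson not_prime_unit)
  qed
  have "2 * (2 * (x\<^sup>2 + x + 1)) = 3 * (1 + 3 * a\<^sup>2) + int p * (int p + 6 * a)"
  proof -
    have "2 * (2 * (x\<^sup>2 + x + 1)) = (2 * x + 1)\<^sup>2 + 3" by (simp add: power2_eq_square algebra_simps)
    also have "2 * x + 1 = 3 * a + int p" using x by simp
    finally show ?thesis by (simp add: power2_eq_square algebra_simps)
  qed
  hence "int p dvd 2 * (2 * (x\<^sup>2 + x + 1))" using dvd by (metis dvd_add dvd_mult dvd_triv_left)
  hence root: "int p dvd x\<^sup>2 + x + 1" using pp ndvd2 prime_dvd_multD by blast
  have "x ^ 3 - 1 = (x\<^sup>2 + x + 1) * (x - 1)" by Groebner_Basis.algebra
  hence x3: "[x ^ 3 = 1] (mod int p)" using root by (simp add: cong_iff_dvd_diff)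
  have nx: "\<not> int p dvd x"
  proof
    assume "int p dvd x"
    moreover have "x\<^sup>2 + x + 1 = x * (x + 1) + 1" by Groebner_Basis.algebra
    ultimately have "int p dvd 1" using root by (simp add: dvd_add_right_iff)
    thus False using pp by (meson not_prime_unit)
  qed
  have xn1: "\<not> [x = 1] (mod int p)"
  proof
    assume "[x = 1] (mod int p)"
    hence "int p dvd x - 1" by (simp add: cong_iff_dvd_diff)
    moreover have "x\<^sup>2 + x + 1 = (x - 1) * (x + 2) + 3" by Groebner_Basis.algebra
    ultimately have "int p dvd 3" using root by (metis dvd_add_right_iff dvd_mult2)
    thus False using ndvd3 by simp
  qed
  have fermat: "[x ^ (p - 1) = 1] (mod int p)"
  proof -
    define y where "y = nat (x mod int p)"
    have p0: "p > 0" using p(1) prime_gt_0_nat by blast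
    have y: "int y = x mod int p" using p0 by (simp add: y_def)
    hence c: "[int y = x] (mod int p)" by (simp add: cong_def)
    hence "\<not> p dvd y" using nx cong_dvd_iff[OF c] by (metis c cong_0_iff cong_sym cong_trans int_dvd_int_iff)
    hence "[y ^ (p - 1) = 1] (mod p)" using fermat_theorem[OF p(1)] by blast
    hence "[int y ^ (p - 1) = 1] (mod int p)" by (metis cong_int_iff of_nat_1 of_nat_power)
    thus ?thesis using cong_pow[OF c, of "p - 1"] cong_sym cong_trans by blast
  qed
  have "p mod 3 \<noteq> 0"
    using ndvd3 primes_dvd_imp_eq[of 3 p] p(1) by (auto simp: mod_eq_0_iff_dvd)
  moreover have "p mod 3 \<noteq> 2"
  proof
    assume "p mod 3 = 2"
    then obtain k where k: "p = 3 * k + 2" by (metis div_mod_decomp mult.commute)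
    have "x ^ (p - 1) = (x ^ 3) ^ k * x" using k by (simp add: power_mult)
    moreover have "[(x ^ 3) ^ k * x = 1 ^ k * x] (mod int p)"
      using x3 by (intro cong_mult cong_pow) auto
    ultimately have "[x = 1] (mod int p)" using fermat cong_sym cong_trans by (metis mult_1 power_one)
    thus False using xn1 by simp
  qed
  ultimately show ?thesis by linarith
qed

section \<open>Prime valuations of factorials\<close>

text \<open>Legendre's recursion: the multiples of \<open>p\<close> up to \<open>p * N + r\<close>
  are \<open>p, 2 p, ..., N p\<close>; removing one factor \<open>p\<close> from each leaves the
  factors of \<open>fact N\<close>.\<close>

lemma multiplicity_fact_split:
  fixes p N r :: nat
  assumes p: "prime p" and r: "r < p"
  shows "multiplicity p (fact (p * N + r) :: nat) = N + multiplicity p (fact N :: nat)"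
proof -
  have pe: "prime_elem p" using p by simp
  have low: "multiplicity p (fact (p * N + r) :: nat) = multiplicity p (fact (p * N) :: nat)"
    if "r < p" for N r
    using that
  proof (induction r)
    case (Suc r)
    have "\<not> p dvd p * N + Suc r" using Suc.prems by (simp only: dvd_add_right_iff[OF dvd_triv_left]) (auto dest: dvd_imp_le)
    hence "multiplicity p (p * N + Suc r) = 0" by (simp add: not_dvd_imp_multiplicity_0)
    moreover have "(fact (p * N + Suc r) :: nat) = (p * N + Suc r) * fact (p * N + r)" by simp
    moreover have "multiplicity p ((p * N + Suc r) * fact (p * N + r))
        = multiplicity p (p * N + Suc r) + multiplicity p (fact (p * N + r) :: nat)"
      by (rule prime_elem_multiplicity_mult_distrib[OF pe]) auto
    ultimately show ?case using Suc by simp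
  qed auto
  have "multiplicity p (fact (p * N) :: nat) = N + multiplicity p (fact N :: nat)"
  proof (induction N)
    case (Suc N)
    have p0: "p > 0" using p prime_gt_0_nat by blast
    have "p * Suc N = Suc (p * N + (p - 1))" using p0 by simp
    hence "(fact (p * Suc N) :: nat) = (p * Suc N) * fact (p * N + (p - 1))"
      by (metis fact_Suc of_nat_id)
    moreover have "multiplicity p (p * Suc N) = Suc (multiplicity p (Suc N))"
      using p by (intro multiplicity_times_same) (auto simp del: mult_Suc_right)
    ultimately have "multiplicity p (fact (p * Suc N) :: nat)
        = Suc (multiplicity p (Suc N)) + multiplicity p (fact (p * N) :: nat)"
      using pe p0 low[of "p - 1" N] by (simp add: prime_elem_multiplicity_mult_distrib del: mult_Suc_right)
    moreover have "multiplicity p (fact (Suc N) :: nat) = multiplicity p (Suc N) + multiplicity p (fact N :: nat)"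
      using pe unfolding fact_Suc by (subst prime_elem_multiplicity_mult_distrib) auto
    ultimately show ?case using Suc by simp
  qed auto
  with low[OF r] show ?thesis by simp
qed

text \<open>In base \<open>p\<close> all digits of \<open>n\<close> equal \<open>(p - 1) / 3\<close>, so doubling \<open>n\<close> produces no carry.\<close>

lemma prime_not_dvd_central_binomial:
  fixes p n f :: nat
  assumes p: "prime p" "p mod 3 = 1" and n: "3 * n + 1 = p ^ f"
  shows "\<not> p dvd (2 * n choose n)"
proof -
  have pe: "prime_elem p" using p by simp
  obtain d where d: "p = 3 * d + 1" using p(2) by (metis div_mod_decomp mult.commute)
  have "multiplicity p (fact (2 * n) :: nat) = 2 * multiplicity p (fact n :: nat)"
    using n
  proof (induction f arbitrary: n)
    case (Suc f)
    have "p ^ f mod 3 = 1" using p(2) by (metis power_mod power_one one_mod_numeral semiring_norm(86) numeral_One mod_less one_less_numeral_iff semiring_norm(77))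
    then obtain m where m: "p ^ f = 3 * m + 1" by (metis div_mod_decomp mult.commute)
    \<comment> \<open>Splits off the last base \<open>p\<close> digit \<open>d\<close>; the
      remaining number \<open>m\<close> satisfies the hypothesis with \<open>f\<close> in place of
      \<open>Suc f\<close>.\<close>
    have "3 * n + 1 = p * (3 * m + 1)" using Suc.prems m by simp
    also have "\<dots> = 3 * (p * m + d) + 1" using d by (simp add: algebra_simps)
    finally have n: "n = p * m + d" by simp
    have "2 * n = p * (2 * m) + 2 * d" by (simp add: n algebra_simps)
    moreover have "2 * d < p" "d < p" using d by auto
    moreover have "multiplicity p (fact (2 * m) :: nat) = 2 * multiplicity p (fact m :: nat)"
      using Suc.IH[of m] m by simp
    ultimately show ?case
      using multiplicity_fact_split[OF p(1), of "2 * d" "2 * m"]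
        multiplicity_fact_split[OF p(1), of d m] n by (metis add_mult_distrib2)
  qed auto
  moreover have "(fact (2 * n) :: nat) = (2 * n choose n) * (fact n * fact n)"
    using binomial_fact_lemma[of n "2 * n"] by (simp add: mult.commute mult_2)
  hence "multiplicity p (fact (2 * n) :: nat)
      = multiplicity p (2 * n choose n) + 2 * multiplicity p (fact n :: nat)"
    using pe by (simp add: prime_elem_multiplicity_mult_distrib)
  ultimately have "multiplicity p (2 * n choose n) = 0" by simp
  thus ?thesis using p(1) by (simp add: prime_elem_multiplicity_eq_zero_iff)
qed

section \<open>Characters and Jacobi sums of a finite field\<close>

lemma prime_CHAR_finite_field: "prime CHAR('a::{finite,field})"
  by (simp add: finite_imp_CHAR_pos prime_CHAR_semidom)

text \<open>For a prime \<open>r\<close> dividing the cardinality, the additive group has a subgroup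
  of order \<open>r\<close>, hence some \<open>x \<noteq> 0\<close> with \<open>r x = 0\<close>. So
  \<open>r\<close> is the characteristic.\<close>

lemma card_finite_field_prime_power:
  obtains f where "f > 0" "card (UNIV :: 'a::{finite,field} set) = CHAR('a) ^ f"
proof -
  define q where "q = card (UNIV :: 'a set)"
  define p where "p = CHAR('a)"
  have p: "prime p" by (simp add: p_def prime_CHAR_finite_field)
  have q1: "q > 1"
    using card_mono[of "UNIV :: 'a set" "{0, 1}"] by (simp add: q_def)
  have only: "r = p" if r: "prime r" "r dvd q" for r
  proof -
    define G where "G = \<lparr>carrier = UNIV :: 'a set, monoid.mult = (+), one = (0 :: 'a)\<rparr>"
    have G: "group G"
      by (rule groupI) (auto simp: G_def add.assoc intro: exI[of _ "- _"])
    obtain m where m: "q = r ^ 1 * m" using r by auto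
    have "\<exists>H. subgroup H G \<and> card H = r ^ 1"
      by (rule sylow_thm[OF r(1) G, of 1 m]) (use m in \<open>auto simp: order_def G_def q_def\<close>)
    then obtain H where H: "subgroup H G" "card H = r" by auto
    have "\<exists>x\<in>H. x \<noteq> 0"
    proof (rule ccontr)
      assume "\<not> ?thesis"
      hence "H \<subseteq> {0}" by auto
      hence "card H \<le> 1" using card_mono[of "{0}" H] by simp
      thus False using H r prime_gt_1_nat[of r] by simp
    qed
    then obtain x where x: "x \<in> H" "x \<noteq> 0" by blast
    interpret K: group "G\<lparr>carrier := H\<rparr>"
      using group.subgroup_imp_group[OF G H(1)] .
    have fin: "finite H" by simp
    have pw: "y [^]\<^bsub>G\<lparr>carrier := H\<rparr>\<^esub> (n::nat) = of_nat n * y" for y n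
      by (induction n) (auto simp: G_def nat_pow_def algebra_simps)
    have "x [^]\<^bsub>G\<lparr>carrier := H\<rparr>\<^esub> order (G\<lparr>carrier := H\<rparr>) = \<one>\<^bsub>G\<lparr>carrier := H\<rparr>\<^esub>"
      by (rule K.pow_order_eq_1) (use x in auto)
    hence "of_nat r * x = 0" unfolding pw using H by (simp add: order_def G_def)
    hence "of_nat r = (0::'a)" using x by simp
    hence "p dvd r" by (simp add: p_def of_nat_eq_0_iff_char_dvd)
    thus ?thesis using p r primes_dvd_imp_eq by blast
  qed
  have "q = p ^ multiplicity p q"
  proof (rule multiplicity_eq_nat)
    fix r :: nat assume r: "prime r"
    show "multiplicity r q = multiplicity r (p ^ multiplicity p q)"
    proof (cases "r = p")
      case True thus ?thesis using p by simp
    next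
      case False
      hence "multiplicity r q = 0" using only r by (auto intro: not_dvd_imp_multiplicity_0)
      thus ?thesis using False r p by (simp add: multiplicity_distinct_prime_power)
    qed
  qed (use q1 p in \<open>auto simp: prime_gt_0_nat\<close>)
  moreover from this have "multiplicity p q > 0" using q1 by (metis gr0I less_irrefl power_0)
  ultimately show ?thesis using that by (simp add: q_def p_def)
qed

lemma root_power_mod:
  fixes z :: "'b::monoid_mult"
  assumes "z ^ n = 1"
  shows "z ^ (k mod n) = z ^ k"
proof -
  have "z ^ k = z ^ (n * (k div n) + k mod n)" by simp
  also have "\<dots> = z ^ (k mod n)" unfolding power_add power_mult assms by simp
  finally show ?thesis by simp
qed

section \<open>Discrete logarithms and cyclotomic classes\<close>

locale primitive_root_field =
  fixes \<gamma> :: "'a::{finite,field}" and q :: nat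
  assumes prim: "primitive_elem \<gamma>" and q_eq: "q = card (UNIV :: 'a set)"
begin

lemma gamma_nonzero [simp]: "\<gamma> \<noteq> 0"
  using prim by (simp add: primitive_elem_def)

lemma card_nonzero: "card (UNIV - {0 :: 'a}) = q - 1"
  by (simp add: q_eq card_Diff_singleton)

lemma q_gt_1: "q > 1"
  using card_mono[of "UNIV :: 'a set" "{0, 1}"] by (simp add: q_eq)

text \<open>Multiplication by \<open>x\<close> permutes the nonzero elements and so preserves their
  product.\<close>

lemma power_q_minus_1:
  fixes x :: 'a
  assumes "x \<noteq> 0"
  shows "x ^ (q - 1) = 1"
proof -
  let ?U = "UNIV - {0 :: 'a}"
  have "(\<Prod>y\<in>?U. y) = (\<Prod>y\<in>?U. x * y)"
    by (rule prod.reindex_bij_witness[where i = "\<lambda>y. x * y" and j = "\<lambda>y. y / x"]) (use assms in auto)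
  also have "\<dots> = x ^ (q - 1) * (\<Prod>y\<in>?U. y)"
    by (simp add: prod.distrib card_nonzero)
  finally show ?thesis by simp
qed

text \<open>The first \<open>q - 1\<close> powers of \<open>\<gamma>\<close> cover all
  \<open>q - 1\<close> nonzero elements, so they are pairwise distinct.\<close>

lemma gamma_power_eq_iff: "\<gamma> ^ k = \<gamma> ^ m \<longleftrightarrow> k mod (q - 1) = m mod (q - 1)"
proof -
  note red = root_power_mod[OF power_q_minus_1[OF gamma_nonzero]]
  have "(\<lambda>k. \<gamma> ^ k) ` {..<q - 1} = UNIV - {0}"
  proof (intro equalityI subsetI)
    fix x :: 'a assume "x \<in> UNIV - {0}"
    then obtain k where "x = \<gamma> ^ k" using prim by (auto simp: primitive_elem_def)
    hence "x = \<gamma> ^ (k mod (q - 1))" by (simp only: red)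
    thus "x \<in> (\<lambda>k. \<gamma> ^ k) ` {..<q - 1}" using q_gt_1 by auto
  qed auto
  hence inj: "inj_on (\<lambda>k. \<gamma> ^ k) {..<q - 1}"
    by (intro eq_card_imp_inj_on) (simp_all add: card_nonzero)
  show ?thesis
  proof
    assume "\<gamma> ^ k = \<gamma> ^ m"
    hence "\<gamma> ^ (k mod (q - 1)) = \<gamma> ^ (m mod (q - 1))" by (simp only: red)
    from inj_onD[OF inj this] q_gt_1 show "k mod (q - 1) = m mod (q - 1)" by simp
  next
    assume "k mod (q - 1) = m mod (q - 1)"
    thus "\<gamma> ^ k = \<gamma> ^ m" by (metis red)
  qed
qed

text \<open>Discrete logarithm to base \<open>\<gamma>\<close>. It has no meaning at 0, and its
  additivity holds only modulo divisors of \<open>q - 1\<close>.\<close>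

definition ind :: "'a \<Rightarrow> nat" where
  "ind x = (LEAST k. \<gamma> ^ k = x)"

lemma gamma_power_ind: "x \<noteq> 0 \<Longrightarrow> \<gamma> ^ ind x = x"
  unfolding ind_def by (rule LeastI_ex) (use prim in \<open>auto simp: primitive_elem_def\<close>)

lemma ind_gamma_power_mod:
  assumes "e dvd q - 1"
  shows "ind (\<gamma> ^ k) mod e = k mod e"
proof -
  have "ind (\<gamma> ^ k) mod (q - 1) = k mod (q - 1)"
    using gamma_power_eq_iff[of "ind (\<gamma> ^ k)" k] gamma_power_ind[of "\<gamma> ^ k"] by simp
  thus ?thesis using assms by (metis mod_mod_cancel)
qed

lemma ind_mult_mod:
  assumes "e dvd q - 1" "x \<noteq> 0" "y \<noteq> 0"
  shows "ind (x * y) mod e = (ind x + ind y) mod e"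
  by (metis assms gamma_power_ind ind_gamma_power_mod power_add)

lemma ind_one_mod: "e dvd q - 1 \<Longrightarrow> ind 1 mod e = 0"
  using ind_gamma_power_mod[of e 0] by simp

lemma ind_mult_cong:
  assumes "e dvd q - 1" "x \<noteq> 0" "y \<noteq> 0" "ind y mod e = 0"
  shows "ind (x * y) mod e = ind x mod e"
  using assms by (metis add.right_neutral ind_mult_mod mod_add_right_eq)

lemma minus_one_eq_gamma_power:
  assumes "q - 1 = 2 * m"
  shows "- 1 = \<gamma> ^ m"
proof -
  have "(\<gamma> ^ m) ^ 2 = 1"
    using power_q_minus_1[OF gamma_nonzero] assms by (simp add: power_mult mult.commute flip: power_mult)
  moreover have "\<gamma> ^ m \<noteq> \<gamma> ^ 0"
    unfolding gamma_power_eq_iff using assms q_gt_1 by simp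
  ultimately show ?thesis by (simp add: power2_eq_1_iff)
qed

text \<open>Turns membership in a class into a congruence on discrete logarithms, the form used in
  the later counts.\<close>

lemma cyclo_class_eq:
  assumes e: "e dvd q - 1"
  shows "cyclo_class \<gamma> e i = {x. x \<noteq> 0 \<and> ind x mod e = i mod e}"
proof (intro equalityI subsetI)
  fix x assume "x \<in> cyclo_class \<gamma> e i"
  thus "x \<in> {x. x \<noteq> 0 \<and> ind x mod e = i mod e}"
    using ind_gamma_power_mod[OF e] by (auto simp: cyclo_class_def)
next
  fix x assume "x \<in> {x. x \<noteq> 0 \<and> ind x mod e = i mod e}"
  hence x: "x \<noteq> 0" "ind x mod e = i mod e" by auto
  \<comment> \<open>\<open>ind x\<close> may be smaller than \<open>i\<close>, while the class asks
    for an exponent \<open>i + e * k\<close> with natural \<open>k\<close>. Adding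
    \<open>(q - 1) * i\<close> lifts it without changing the power.\<close>
  define n where "n = ind x + (q - 1) * i"
  have "1 * i \<le> (q - 1) * i" using q_gt_1 by (intro mult_right_mono) auto
  hence le: "i \<le> n" unfolding n_def by linarith
  have "(q - 1) * i mod e = 0" using e by auto
  hence "n mod e = i mod e" using x(2) unfolding n_def by (metis add.right_neutral mod_add_right_eq)
  hence "e dvd n - i" using le by (metis mod_eq_dvd_iff_nat)
  then obtain k where "n - i = e * k" by auto
  hence "n = i + e * k" using le by simp
  moreover have "x = \<gamma> ^ n"
    using gamma_power_ind[OF x(1)] gamma_power_eq_iff[of "ind x" n] by (simp add: n_def)
  ultimately show "x \<in> cyclo_class \<gamma> e i" by (auto simp: cyclo_class_def)
qed

lemma card_cyclo_class:
  assumes e: "q - 1 = e * l" and i: "i < e"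
  shows "card (cyclo_class \<gamma> e i) = l"
proof -
  have bound: "i + e * k < q - 1" if "k < l" for k
  proof -
    have "e * Suc k \<le> e * l" using that by (intro mult_left_mono) auto
    thus ?thesis using e i by simp
  qed
  have "inj_on (\<lambda>k. \<gamma> ^ (i + e * k)) {..<l}"
    using bound i by (auto simp: inj_on_def gamma_power_eq_iff)
  moreover have "cyclo_class \<gamma> e i = (\<lambda>k. \<gamma> ^ (i + e * k)) ` {..<l}"
  proof (intro equalityI subsetI)
    fix x assume "x \<in> cyclo_class \<gamma> e i"
    then obtain k where k: "x = \<gamma> ^ (i + e * k)" by (auto simp: cyclo_class_def)
    have l: "l > 0" using e q_gt_1 by (cases l) auto
    have "x = \<gamma> ^ (i + e * (k mod l))"
      unfolding k gamma_power_eq_iff using e by (metis mod_add_right_eq mult_mod_right)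
    thus "x \<in> (\<lambda>k. \<gamma> ^ (i + e * k)) ` {..<l}" using l by auto
  qed (auto simp: cyclo_class_def)
  ultimately show ?thesis by (simp add: card_image)
qed

text \<open>The character sending \<open>\<gamma>\<close> to \<open>\<zeta>\<close>; it is multiplicative only if \<open>\<zeta> ^ (q - 1) = 1\<close>.\<close>

definition mchar :: "complex \<Rightarrow> 'a \<Rightarrow> complex" where
  "mchar \<zeta> x = (if x = 0 then 0 else \<zeta> ^ ind x)"

lemma root_nonzero:
  fixes \<zeta> :: complex
  assumes "\<zeta> ^ (q - 1) = 1"
  shows "\<zeta> \<noteq> 0"
  using assms q_gt_1 by (auto simp: power_0_left split: if_splits)

lemma mchar_0 [simp]: "mchar \<zeta> 0 = 0"
  by (simp add: mchar_def)

lemma mchar_gamma_power: "\<zeta> ^ (q - 1) = 1 \<Longrightarrow> mchar \<zeta> (\<gamma> ^ k) = \<zeta> ^ k"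
  using root_power_mod[of \<zeta> "q - 1"] ind_gamma_power_mod[of "q - 1" k]
  by (simp add: mchar_def) metis

lemma mchar_1 [simp]: "\<zeta> ^ (q - 1) = 1 \<Longrightarrow> mchar \<zeta> 1 = 1"
  using mchar_gamma_power[of \<zeta> 0] by simp

lemma mchar_mult:
  assumes "\<zeta> ^ (q - 1) = 1"
  shows "mchar \<zeta> (x * y) = mchar \<zeta> x * mchar \<zeta> y"
proof (cases "x = 0 \<or> y = 0")
  case False
  hence "mchar \<zeta> (x * y) = mchar \<zeta> (\<gamma> ^ (ind x + ind y))"
    by (simp add: power_add gamma_power_ind)
  also have "\<dots> = \<zeta> ^ (ind x + ind y)" by (rule mchar_gamma_power[OF assms])
  finally show ?thesis using False by (simp add: mchar_def power_add)
qed auto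

lemma mchar_inverse:
  assumes "\<zeta> ^ (q - 1) = 1"
  shows "mchar \<zeta> (inverse x) = inverse (mchar \<zeta> x)"
proof (cases "x = 0")
  case False
  hence "mchar \<zeta> x * mchar \<zeta> (inverse x) = 1"
    using mchar_mult[OF assms, of x "inverse x"] assms by simp
  thus ?thesis using False by (simp add: inverse_unique)
qed auto

lemma mchar_mult_root: "mchar \<zeta> x * mchar \<xi> x = mchar (\<zeta> * \<xi>) x"
  by (simp add: mchar_def power_mult_distrib)

lemma mchar_inverse_root: "mchar (inverse \<zeta>) x = inverse (mchar \<zeta> x)"
  by (simp add: mchar_def power_inverse)

lemma cnj_mchar: "cnj (mchar \<zeta> x) = mchar (cnj \<zeta>) x"
  by (simp add: mchar_def)

lemma mchar_root_1: "mchar 1 x = of_bool (x \<noteq> 0)"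
  by (simp add: mchar_def)

text \<open>Substituting \<open>\<gamma> * x\<close> for \<open>x\<close> multiplies the sum by
  \<open>\<zeta> \<noteq> 1\<close>.\<close>

lemma sum_mchar:
  assumes "\<zeta> ^ (q - 1) = 1" "\<zeta> \<noteq> 1"
  shows "(\<Sum>x\<in>UNIV. mchar \<zeta> x) = 0"
proof -
  have "(\<Sum>x\<in>UNIV. mchar \<zeta> x) = (\<Sum>x\<in>UNIV. mchar \<zeta> (\<gamma> * x))"
    by (rule sum.reindex_bij_witness[where i = "\<lambda>y. \<gamma> * y" and j = "\<lambda>y. y / \<gamma>"]) auto
  also have "\<dots> = \<zeta> * (\<Sum>x\<in>UNIV. mchar \<zeta> x)"
    using mchar_gamma_power[OF assms(1), of 1] by (simp add: mchar_mult[OF assms(1)] sum_distrib_left)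
  finally show ?thesis using assms(2) by simp
qed

section \<open>Jacobi sums\<close>

text \<open>A character is represented by its value at \<open>\<gamma>\<close>, so the intended
  arguments are roots of unity; 1 stands for the trivial character, which here vanishes at
  0.\<close>

definition jacobi_sum :: "complex \<Rightarrow> complex \<Rightarrow> complex" where
  "jacobi_sum \<zeta> \<xi> = (\<Sum>x\<in>UNIV. mchar \<zeta> x * mchar \<xi> (1 - x))"

lemma jacobi_sum_commute: "jacobi_sum \<zeta> \<xi> = jacobi_sum \<xi> \<zeta>"
  unfolding jacobi_sum_def
  by (rule sum.reindex_bij_witness[where i = "\<lambda>x. 1 - x" and j = "\<lambda>x. 1 - x"]) (auto simp: mult.commute)

lemma cnj_jacobi_sum: "cnj (jacobi_sum \<zeta> \<xi>) = jacobi_sum (cnj \<zeta>) (cnj \<xi>)"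
  by (simp add: jacobi_sum_def cnj_mchar)

text \<open>Because the trivial character is 0 at 0, one term of value 1 is missing from a full
  character sum that vanishes.\<close>

lemma jacobi_sum_1_left:
  assumes "\<zeta> ^ (q - 1) = 1" "\<zeta> \<noteq> 1"
  shows "jacobi_sum 1 \<zeta> = - 1"
proof -
  have "jacobi_sum 1 \<zeta> = jacobi_sum \<zeta> 1" by (rule jacobi_sum_commute)
  also have "\<dots> = (\<Sum>x\<in>UNIV - {1}. mchar \<zeta> x)"
    unfolding jacobi_sum_def mchar_root_1 by (rule sum.mono_neutral_cong_right) auto
  also have "\<dots> = - 1" using sum_mchar[OF assms] assms(1) by (simp add: sum_diff1)
  finally show ?thesis .
qed

text \<open>Substitute \<open>x / (x - 1)\<close> for \<open>x\<close>.\<close>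

lemma jacobi_sum_reflect:
  assumes \<zeta>: "\<zeta> ^ (q - 1) = 1" and \<xi>: "\<xi> ^ (q - 1) = 1" and neg: "mchar \<zeta> (- 1) = 1"
  shows "jacobi_sum \<zeta> \<xi> = jacobi_sum \<zeta> (inverse (\<zeta> * \<xi>))"
proof -
  have restrict: "jacobi_sum \<zeta> \<eta> = (\<Sum>x\<in>UNIV - {1}. mchar \<zeta> x * mchar \<eta> (1 - x))" for \<eta>
    unfolding jacobi_sum_def by (rule sum.mono_neutral_right) auto
  show ?thesis unfolding restrict
  proof (rule sum.reindex_bij_witness[where i = "\<lambda>x. x / (x - 1)" and j = "\<lambda>x. x / (x - 1)"])
    fix x :: 'a assume "x \<in> UNIV - {1}"
    hence x: "x - 1 \<noteq> 0" "1 - x \<noteq> 0" by auto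
    show "x / (x - 1) / (x / (x - 1) - 1) = x" "x / (x - 1) / (x / (x - 1) - 1) = x"
      using x by (simp_all add: divide_simps)
    show "x / (x - 1) \<in> UNIV - {1}" "x / (x - 1) \<in> UNIV - {1}" using x by (auto simp: divide_simps)
    \<comment> \<open>The factor \<open>- 1\<close> is why the character is assumed to be 1
      there.\<close>
    have e: "x / (x - 1) = x * inverse (1 - x) * (- 1)" "1 - x / (x - 1) = inverse (1 - x)"
      using x by (simp_all add: divide_simps) (simp_all add: algebra_simps)
    have "mchar \<zeta> (x / (x - 1)) = mchar \<zeta> x * inverse (mchar \<zeta> (1 - x))"
      unfolding e by (simp only: mchar_mult[OF \<zeta>] mchar_inverse[OF \<zeta>] neg mult_1_right)
    moreover have "mchar \<zeta> (1 - x) \<noteq> 0" using x root_nonzero[OF \<zeta>] by (simp add: mchar_def)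
    ultimately have m: "mchar \<zeta> x = mchar \<zeta> (x / (x - 1)) * mchar \<zeta> (1 - x)" by simp
    have "mchar (inverse (\<zeta> * \<xi>)) (1 - x / (x - 1)) = mchar (\<zeta> * \<xi>) (1 - x)"
    proof -
      have "(\<zeta> * \<xi>) ^ (q - 1) = 1" using \<zeta> \<xi> by (simp add: power_mult_distrib)
      thus ?thesis unfolding e(2) by (simp only: mchar_inverse_root mchar_inverse inverse_inverse_eq)
    qed
    thus "mchar \<zeta> (x / (x - 1)) * mchar (inverse (\<zeta> * \<xi>)) (1 - x / (x - 1)) = mchar \<zeta> x * mchar \<xi> (1 - x)"
      unfolding m by (simp add: mchar_mult_root mult.assoc)
  qed
qed

text \<open>Reflection turns the second character into the trivial one.\<close>

lemma jacobi_sum_inverse: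
  assumes \<zeta>: "\<zeta> ^ (q - 1) = 1" "\<zeta> \<noteq> 1" and neg: "mchar \<zeta> (- 1) = 1"
  shows "jacobi_sum \<zeta> (inverse \<zeta>) = - 1"
proof -
  have "jacobi_sum \<zeta> (inverse \<zeta>) = jacobi_sum \<zeta> 1"
    using jacobi_sum_reflect[OF \<zeta>(1) _ neg, of "inverse \<zeta>"] \<zeta> root_nonzero[OF \<zeta>(1)] by (simp add: power_inverse)
  thus ?thesis using jacobi_sum_1_left[OF \<zeta>] by (simp add: jacobi_sum_commute)
qed

text \<open>\<open>mchar (- 1)\<close> is the quadratic character: an even index gives two opposite
  roots, an odd index none, and 0 has one root.\<close>

lemma card_square_roots:
  assumes even: "q - 1 = 2 * m" and two: "(2 :: 'a) \<noteq> 0"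
  shows "of_nat (card {y. y\<^sup>2 = z}) = 1 + mchar (- 1) z"
proof (cases "z = 0")
  case False
  show ?thesis
  proof (cases "even (ind z)")
    case True
    define s where "s = \<gamma> ^ (ind z div 2)"
    have s2: "s\<^sup>2 = z" using True gamma_power_ind[OF False] by (simp add: s_def flip: power_mult)
    have "{y. y\<^sup>2 = z} = {s, - s}" unfolding s2[symmetric] by (auto simp: power2_eq_iff)
    moreover have "s \<noteq> - s"
    proof
      assume "s = - s"
      hence "2 * s = 0" by (metis mult_2 add.right_inverse)
      thus False using two by (simp add: s_def)
    qed
    ultimately show ?thesis using True False by (simp add: mchar_def)
  next
    case odd: False
    have "{y. y\<^sup>2 = z} = {}"
    proof safe
      fix y assume y: "z = y\<^sup>2"
      hence "y \<noteq> 0" using False by auto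
      hence "ind (y * y) mod 2 = (ind y + ind y) mod 2" by (intro ind_mult_mod) (use even in auto)
      hence "ind (y * y) mod 2 = 0" by simp
      thus "y \<in> {}" using odd y by (simp add: power2_eq_square even_iff_mod_2_eq_zero)
    qed
    thus ?thesis using odd False by (simp add: mchar_def)
  qed
qed auto

text \<open>Completing the square: \<open>x (1 - x) = (1 - (2 x - 1)\<^sup>2) / 4\<close>.\<close>

lemma jacobi_sum_diag:
  assumes even: "q - 1 = 2 * m" and two: "(2 :: 'a) \<noteq> 0"
    and \<zeta>: "\<zeta> ^ (q - 1) = 1" "\<zeta> \<noteq> 1" and four: "mchar \<zeta> 4 = 1"
  shows "jacobi_sum \<zeta> \<zeta> = jacobi_sum (- 1) \<zeta>"
proof -
  have "jacobi_sum \<zeta> \<zeta> = (\<Sum>x\<in>UNIV. mchar \<zeta> (4 * (x * (1 - x))))"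
    by (simp add: jacobi_sum_def mchar_mult[OF \<zeta>(1)] four)
  also have "\<dots> = (\<Sum>y\<in>UNIV. mchar \<zeta> (1 - y\<^sup>2))"
  proof (rule sum.reindex_bij_witness[where i = "\<lambda>y. (1 + y) / 2" and j = "\<lambda>x. 2 * x - 1"])
    fix x :: 'a
    show "mchar \<zeta> (1 - (2 * x - 1)\<^sup>2) = mchar \<zeta> (4 * (x * (1 - x)))"
      by (rule arg_cong[where f = "mchar \<zeta>"]) (simp add: power2_eq_square algebra_simps)
  qed (use two in \<open>auto simp: divide_simps\<close>)
  \<comment> \<open>Grouping by the value of \<open>y^2\<close> brings in the quadratic character
    through the number of square roots.\<close>
  also have "\<dots> = (\<Sum>z\<in>UNIV. \<Sum>y | y \<in> UNIV \<and> y\<^sup>2 = z. mchar \<zeta> (1 - y\<^sup>2))"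
    by (rule sum.group[symmetric]) auto
  also have "\<dots> = (\<Sum>z\<in>UNIV. (1 + mchar (- 1) z) * mchar \<zeta> (1 - z))"
    by (rule sum.cong) (auto simp flip: card_square_roots[OF even two])
  also have "\<dots> = (\<Sum>z\<in>UNIV. mchar \<zeta> (1 - z)) + jacobi_sum (- 1) \<zeta>"
    by (simp add: jacobi_sum_def algebra_simps sum.distrib)
  also have "(\<Sum>z\<in>UNIV. mchar \<zeta> (1 - z)) = (\<Sum>z\<in>UNIV. mchar \<zeta> z)"
    by (rule sum.reindex_bij_witness[where i = "\<lambda>x. 1 - x" and j = "\<lambda>x. 1 - x"]) auto
  also have "\<dots> = 0" by (rule sum_mchar[OF \<zeta>])
  finally show ?thesis by simp
qed

lemma sum_mchar_minus_0_1:
  assumes "\<zeta> ^ (q - 1) = 1" "\<zeta> \<noteq> 1"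
  shows "(\<Sum>x\<in>UNIV - {0, 1}. mchar \<zeta> x) = - 1"
proof -
  have "(\<Sum>x\<in>UNIV - {0, 1}. mchar \<zeta> x) = (\<Sum>x\<in>UNIV - {1}. mchar \<zeta> x)"
    by (rule sum.mono_neutral_left) auto
  thus ?thesis using sum_mchar[OF assms] assms(1) by (simp add: sum_diff1)
qed

text \<open>Off the diagonal, \<open>(x, y) \<mapsto> (x / y, (1 - x) / (1 - y))\<close> permutes the pairs of distinct
  elements outside \<open>{0, 1}\<close>; this replaces the usual argument with Gauss sums.\<close>

lemma jacobi_sum_norm:
  assumes \<zeta>: "\<zeta> ^ (q - 1) = 1" "\<zeta> \<noteq> 1" and \<xi>: "\<xi> ^ (q - 1) = 1" "\<xi> \<noteq> 1" and "\<zeta> * \<xi> \<noteq> 1"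
  shows "jacobi_sum \<zeta> \<xi> * jacobi_sum (inverse \<zeta>) (inverse \<xi>) = of_nat q"
proof -
  let ?X = "UNIV - {0, 1 :: 'a}"
  have restrict: "jacobi_sum \<eta> \<theta> = (\<Sum>x\<in>?X. mchar \<eta> x * mchar \<theta> (1 - x))" for \<eta> \<theta>
    unfolding jacobi_sum_def by (rule sum.mono_neutral_right) auto
  define F where "F x y = mchar \<zeta> (x / y) * mchar \<xi> ((1 - x) / (1 - y))" for x y
  have F: "mchar \<zeta> x * mchar \<xi> (1 - x) * (mchar (inverse \<zeta>) y * mchar (inverse \<xi>) (1 - y)) = F x y" for x y
    by (simp add: F_def divide_inverse mchar_mult[OF \<zeta>(1)] mchar_mult[OF \<xi>(1)]
        mchar_inverse[OF \<zeta>(1)] mchar_inverse[OF \<xi>(1)] mchar_inverse_root)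
  have split: "(\<Sum>p\<in>?X \<times> ?X. f p) = (\<Sum>x\<in>?X. f (x, x)) + (\<Sum>p\<in>?X \<times> ?X - Id. f p)"
    for f :: "'a \<times> 'a \<Rightarrow> complex"
  proof -
    have "(\<Sum>p\<in>?X \<times> ?X. f p) = (\<Sum>p\<in>(?X \<times> ?X) \<inter> Id. f p) + (\<Sum>p\<in>?X \<times> ?X - Id. f p)"
      by (rule sum.Int_Diff) simp
    also have "(\<Sum>p\<in>(?X \<times> ?X) \<inter> Id. f p) = (\<Sum>x\<in>?X. f (x, x))"
      by (rule sum.reindex_bij_witness[where i = "\<lambda>x. (x, x)" and j = fst]) auto
    finally show ?thesis .
  qed
  have "jacobi_sum \<zeta> \<xi> * jacobi_sum (inverse \<zeta>) (inverse \<xi>) = (\<Sum>(x, y)\<in>?X \<times> ?X. F x y)"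
    unfolding restrict by (simp add: sum_product F sum.cartesian_product)
  also have "\<dots> = (\<Sum>x\<in>?X. F x x) + (\<Sum>(x, y)\<in>?X \<times> ?X - Id. F x y)"
    by (subst split) simp
  also have "(\<Sum>x\<in>?X. F x x) = (\<Sum>x\<in>?X. 1)"
    by (rule sum.cong) (auto simp: F_def mchar_1[OF \<zeta>(1)] mchar_1[OF \<xi>(1)])
  also have "\<dots> = of_nat q - 2"
    using q_gt_1 by (simp add: q_eq card_Diff_subset of_nat_diff)
  \<comment> \<open>The inverse map comes from solving \<open>x = u * y\<close> and
    \<open>1 - x = v * (1 - y)\<close>, which gives \<open>y = (1 - v) / (u - v)\<close>.\<close>
  also have "(\<Sum>(x, y)\<in>?X \<times> ?X - Id. F x y) = (\<Sum>(u, v)\<in>?X \<times> ?X - Id. mchar \<zeta> u * mchar \<xi> v)"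
  proof (rule sum.reindex_bij_witness[where
        i = "\<lambda>(u, v). (u * ((1 - v) / (u - v)), (1 - v) / (u - v))" and
        j = "\<lambda>(x, y). (x / y, (1 - x) / (1 - y))"], goal_cases)
    case (1 p)
    then obtain x y where p: "p = (x, y)" "x \<noteq> 0" "x \<noteq> 1" "y \<noteq> 0" "y \<noteq> 1" "x \<noteq> y" by auto
    have "x / y - (1 - x) / (1 - y) = (x - y) / (y * (1 - y))"
      using p by (simp add: divide_simps) (simp add: algebra_simps)
    moreover have "1 - (1 - x) / (1 - y) = (x - y) / (1 - y)"
      using p by (simp add: divide_simps)
    ultimately have "(1 - (1 - x) / (1 - y)) / (x / y - (1 - x) / (1 - y)) = y"
      using p by simp
    hence "(\<lambda>(u, v). (u * ((1 - v) / (u - v)), (1 - v) / (u - v))) (x / y, (1 - x) / (1 - y)) = (x / y * y, y)"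
      by (simp only: prod.case)
    thus ?case using p by simp
  next
    case (2 p)
    then obtain x y where p: "p = (x, y)" "x \<noteq> 0" "x \<noteq> 1" "y \<noteq> 0" "y \<noteq> 1" "x \<noteq> y" by auto
    have "x / y \<noteq> (1 - x) / (1 - y)" using p by (auto simp: divide_simps algebra_simps)
    thus ?case using p by auto
  next
    case (3 p)
    then obtain u v where p: "p = (u, v)" "u \<noteq> 0" "u \<noteq> 1" "v \<noteq> 0" "v \<noteq> 1" "u \<noteq> v" by auto
    define y where "y = (1 - v) / (u - v)"
    have y: "y \<noteq> 0" using p by (simp add: y_def)
    have y1: "1 - y = (u - 1) / (u - v)" using p by (simp add: y_def divide_simps)
    have y2: "1 - u * y = v * (u - 1) / (u - v)" using p by (simp add: y_def divide_simps) (simp add: algebra_simps)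
    have "(1 - u * y) / (1 - y) = v" unfolding y1 y2 using p by simp
    thus ?case unfolding p(1) prod.case y_def[symmetric] using p y by simp
  next
    case (4 p)
    then obtain u v where p: "p = (u, v)" "u \<noteq> 0" "u \<noteq> 1" "v \<noteq> 0" "v \<noteq> 1" "u \<noteq> v" by auto
    define y where "y = (1 - v) / (u - v)"
    have y: "y \<noteq> 0" using p by (simp add: y_def)
    have y1: "1 - y = (u - 1) / (u - v)" using p by (simp add: y_def divide_simps)
    have y2: "1 - u * y = v * (u - 1) / (u - v)" using p by (simp add: y_def divide_simps) (simp add: algebra_simps)
    have "1 - y \<noteq> 0" "1 - u * y \<noteq> 0" unfolding y1 y2 using p by auto
    hence "y \<noteq> 1" "u * y \<noteq> 1" by auto
    thus ?case unfolding p(1) prod.case y_def[symmetric] using p y by auto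
  next
    case (5 p)
    thus ?case by (auto simp: F_def)
  qed
  \<comment> \<open>The sum over all pairs is \<open>(- 1) * (- 1)\<close>, and the diagonal
    contributes \<open>- 1\<close> because \<open>\<zeta> * \<xi> \<noteq> 1\<close>.\<close>
  also have "\<dots> = 2"
  proof -
    have "(\<Sum>u\<in>?X. mchar \<zeta> u) * (\<Sum>v\<in>?X. mchar \<xi> v) = (\<Sum>(u, v)\<in>?X \<times> ?X. mchar \<zeta> u * mchar \<xi> v)"
      by (simp add: sum_product sum.cartesian_product)
    also have "\<dots> = (\<Sum>u\<in>?X. mchar (\<zeta> * \<xi>) u) + (\<Sum>(u, v)\<in>?X \<times> ?X - Id. mchar \<zeta> u * mchar \<xi> v)"
      by (subst split) (simp add: mchar_mult_root)
    finally show ?thesis using assms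
      by (simp add: sum_mchar_minus_0_1 power_mult_distrib)
  qed
  finally show ?thesis by simp
qed

end

section \<open>Orbit counting and sums of cube roots of unity\<close>

lemma even_card_if_involution:
  assumes "finite S" and "\<And>x. x \<in> S \<Longrightarrow> g x \<in> S \<and> g (g x) = x \<and> g x \<noteq> x"
  shows "even (card S)"
  using assms
proof (induction S rule: finite_psubset_induct)
  case (psubset S)
  show ?case
  proof (cases "S = {}")
    case False
    then obtain x where x: "x \<in> S" by blast
    let ?O = "{x, g x}"
    have O: "?O \<subseteq> S" "card ?O = 2" using x psubset.prems[OF x] by auto
    have "S - ?O \<subset> S" using x by blast
    moreover have "g y \<in> S - ?O \<and> g (g y) = y \<and> g y \<noteq> y" if y: "y \<in> S - ?O" for y
      using y psubset.prems[of y] psubset.prems[OF x] by (metis Diff_iff insert_iff singletonD)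
    ultimately have "even (card (S - ?O))" using psubset.IH by blast
    moreover have "card S = card (S - ?O) + 2"
      using O psubset.hyps card_mono[OF _ O(1)] by (simp add: card_Diff_subset)
    ultimately show ?thesis by simp
  qed simp
qed

text \<open>\<open>g (g x) = x\<close> would give \<open>g x = x\<close>, so every orbit has exactly
  three elements.\<close>

lemma three_dvd_card_if_order_3:
  assumes "finite S" and "\<And>x. x \<in> S \<Longrightarrow> g x \<in> S \<and> g (g (g x)) = x \<and> g x \<noteq> x"
  shows "3 dvd card S"
  using assms
proof (induction S rule: finite_psubset_induct)
  case (psubset S)
  show ?case
  proof (cases "S = {}")
    case False
    then obtain x where x: "x \<in> S" by blast
    let ?O = "{x, g x, g (g x)}"
    have gx: "g x \<in> S" "g (g (g x)) = x" "g x \<noteq> x" using psubset.prems[OF x] by auto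
    have ggx: "g (g x) \<in> S" "g (g x) \<noteq> g x" using psubset.prems[OF gx(1)] by auto
    have "g (g x) \<noteq> x" using gx by metis
    hence O: "?O \<subseteq> S" "card ?O = 3" using x gx ggx by auto
    have "S - ?O \<subset> S" using x by blast
    moreover have "g y \<in> S - ?O \<and> g (g (g y)) = y \<and> g y \<noteq> y" if y: "y \<in> S - ?O" for y
    proof -
      have "g y \<in> S" "g (g (g y)) = y" "g y \<noteq> y" using y psubset.prems[of y] by auto
      thus ?thesis using y gx by auto
    qed
    ultimately have "3 dvd card (S - ?O)" using psubset.IH by blast
    moreover have "card S = card (S - ?O) + 3"
      using O psubset.hyps card_mono[OF _ O(1)] by (simp add: card_Diff_subset)
    ultimately show ?thesis by simp
  qed simp
qed

text \<open>Stated over any commutative ring, as \<open>z\<close> will be the complex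
  \<open>\<omega>\<close>, a cube root of unity in the finite field, and also 1, where it only
  counts.\<close>

lemma sum_cube_root_power:
  fixes z :: "'b::comm_ring_1" and k :: "'c \<Rightarrow> nat"
  assumes "finite X" "z ^ 3 = 1"
  shows "(\<Sum>x\<in>X. z ^ k x) = of_nat (card {x \<in> X. k x mod 3 = 0})
    + of_nat (card {x \<in> X. k x mod 3 = 1}) * z + of_nat (card {x \<in> X. k x mod 3 = 2}) * z\<^sup>2"
proof -
  have "(\<Sum>x\<in>X. z ^ k x) = (\<Sum>i\<in>{0, 1, 2}. \<Sum>x | x \<in> X \<and> k x mod 3 = i. z ^ k x)"
    by (rule sum.group[symmetric]) (use assms in auto)
  also have "\<dots> = (\<Sum>i\<in>{0, 1, 2}. \<Sum>x | x \<in> X \<and> k x mod 3 = i. z ^ i)"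
    by (intro sum.cong refl) (auto simp: root_power_mod[OF assms(2)])
  finally show ?thesis by (simp add: algebra_simps)
qed

text \<open>The cube root of unity \<open>exp (2 pi i / 3)\<close>, in coordinates so that real and
  imaginary parts can be compared.\<close>

definition \<omega> :: complex where
  "\<omega> = Complex (- 1 / 2) (sqrt 3 / 2)"

lemma omega_sum: "1 + \<omega> + \<omega>\<^sup>2 = 0"
  by (simp add: \<omega>_def power2_eq_square complex_eq_iff field_simps)

lemma omega_cube: "\<omega> ^ 3 = 1"
proof -
  have "\<omega> ^ 3 - 1 = (\<omega> - 1) * (1 + \<omega> + \<omega>\<^sup>2)" by (simp add: algebra_simps power2_eq_square power3_eq_cube)
  thus ?thesis by (simp add: omega_sum)
qed

lemma omega_nontrivial: "\<omega> \<noteq> 1" "\<omega>\<^sup>2 \<noteq> 1" "\<omega> \<noteq> - 1"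
  using omega_sum by (auto simp: \<omega>_def complex_eq_iff power2_eq_square)

lemma cnj_omega: "cnj \<omega> = \<omega>\<^sup>2"
  by (simp add: \<omega>_def power2_eq_square complex_eq_iff field_simps)

lemma inverse_omega: "inverse \<omega> = \<omega>\<^sup>2"
  using omega_cube by (intro inverse_unique) (simp add: power2_eq_square power3_eq_cube mult.assoc)

lemma sixth_roots:
  assumes "\<zeta> \<in> {1, \<omega>, \<omega>\<^sup>2, - 1, - \<omega>, - (\<omega>\<^sup>2)}"
  shows "\<zeta> ^ 6 = 1"
proof -
  have "\<omega> ^ 6 = (\<omega> ^ 3)\<^sup>2" "\<omega> ^ 12 = (\<omega> ^ 3) ^ 4" by (simp_all flip: power_mult)
  hence "\<omega> ^ 6 = 1" "(\<omega>\<^sup>2) ^ 6 = 1" by (simp_all add: omega_cube flip: power_mult)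
  thus ?thesis using assms by (auto simp: power_minus_even)
qed

text \<open>Orthogonality of the characters of order dividing 6: the coefficient of a root
  \<open>\<zeta>\<close> is \<open>\<zeta> ^ 3\<close>, which is 1 at the cube roots of unity and
  \<open>- 1\<close> at their negatives.\<close>

lemma sixth_root_indicator:
  "1 ^ n + \<omega> ^ n + (\<omega>\<^sup>2) ^ n - (- 1) ^ n - (- \<omega>) ^ n - (- (\<omega>\<^sup>2)) ^ n = 6 * of_bool (n mod 6 = 3)"
proof -
  have red: "\<zeta> ^ n = \<zeta> ^ (n mod 6)" if "\<zeta> \<in> {1, \<omega>, \<omega>\<^sup>2, - 1, - \<omega>, - (\<omega>\<^sup>2)}" for \<zeta>
    using root_power_mod[OF sixth_roots[OF that]] by simp
  have w2: "\<omega>\<^sup>2 = - 1 - \<omega>" using omega_sum by (simp add: algebra_simps add_eq_0_iff)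
  have w4: "\<omega> ^ 4 = \<omega>" "\<omega> ^ 5 = \<omega>\<^sup>2" "\<omega> ^ 6 = 1" "\<omega> ^ 8 = \<omega>\<^sup>2" "\<omega> ^ 10 = \<omega>"
  proof -
    have "\<omega> ^ 4 = \<omega> ^ 3 * \<omega>" "\<omega> ^ 5 = \<omega> ^ 3 * \<omega>\<^sup>2" "\<omega> ^ 6 = (\<omega> ^ 3)\<^sup>2"
      "\<omega> ^ 8 = (\<omega> ^ 3)\<^sup>2 * \<omega>\<^sup>2" "\<omega> ^ 10 = (\<omega> ^ 3) ^ 3 * \<omega>"
      by (simp_all add: eval_nat_numeral)
    thus "\<omega> ^ 4 = \<omega>" "\<omega> ^ 5 = \<omega>\<^sup>2" "\<omega> ^ 6 = 1" "\<omega> ^ 8 = \<omega>\<^sup>2" "\<omega> ^ 10 = \<omega>"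
      by (simp_all add: omega_cube)
  qed
  have w0: "2 * \<omega>\<^sup>2 + (2 * \<omega> + 2) = 0" "2 * \<omega> + (2 * \<omega>\<^sup>2 + 2) = 0" by (simp_all add: w2)
  have "n mod 6 \<in> {0, 1, 2, 3, 4, 5}" by auto
  moreover have "1 ^ m + \<omega> ^ m + (\<omega>\<^sup>2) ^ m - (- 1) ^ m - (- \<omega>) ^ m - (- (\<omega>\<^sup>2)) ^ m = 6 * of_bool (m = 3)"
    if "m \<in> {0, 1, 2, 3, 4, 5}" for m :: nat
    using that by (auto simp: omega_cube w4 w0 power_minus_even power_minus_odd simp flip: power_mult)
  ultimately show ?thesis
    using red[of 1] red[of \<omega>] red[of "\<omega>\<^sup>2"] red[of "- 1"] red[of "- \<omega>"] red[of "- (\<omega>\<^sup>2)"] by simp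
qed

lemma omega_combination: "of_real x + of_real y * \<omega> + of_real z * \<omega>\<^sup>2
    = Complex (x - (y + z) / 2) ((y - z) / 2 * sqrt 3)"
  by (simp add: \<omega>_def power2_eq_square complex_eq_iff field_simps)

section \<open>Power sums in the field\<close>

context primitive_root_field
begin

lemma of_nat_q: "of_nat q = (0 :: 'a)"
  unfolding q_eq of_nat_eq_0_iff_char_dvd by (rule CHAR_dvd_CARD)

text \<open>If \<open>q - 1\<close> divides \<open>k\<close>, every nonzero element contributes 1;
  otherwise substituting \<open>\<gamma> * x\<close> multiplies the sum by
  \<open>\<gamma> ^ k \<noteq> 1\<close>.\<close>

lemma sum_powers:
  assumes "k > 0"
  shows "(\<Sum>x\<in>UNIV. (x :: 'a) ^ k) = (if q - 1 dvd k then - 1 else 0)"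
proof (cases "q - 1 dvd k")
  case True
  then obtain m where m: "k = (q - 1) * m" by auto
  have "(\<Sum>x\<in>UNIV. (x :: 'a) ^ k) = (\<Sum>x\<in>UNIV - {0 :: 'a}. 1)"
    by (rule sum.mono_neutral_cong_right)
      (use assms power_q_minus_1 in \<open>auto simp: m power_mult simp del: One_nat_def\<close>)
  also have "\<dots> = of_nat q - 1" using q_gt_1 by (simp add: card_nonzero of_nat_diff)
  finally show ?thesis using True by (simp add: of_nat_q)
next
  case False
  have "(\<Sum>x\<in>UNIV. x ^ k) = (\<Sum>x\<in>UNIV. (\<gamma> * x) ^ k)"
    by (rule sum.reindex_bij_witness[where i = "\<lambda>y. \<gamma> * y" and j = "\<lambda>y. y / \<gamma>"]) auto
  also have "\<dots> = \<gamma> ^ k * (\<Sum>x\<in>UNIV. x ^ k)"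
    by (simp add: power_mult_distrib sum_distrib_left)
  finally have "\<gamma> ^ k = 1 \<or> (\<Sum>x\<in>UNIV. (x :: 'a) ^ k) = 0" by auto
  moreover have "\<gamma> ^ k \<noteq> \<gamma> ^ 0" unfolding gamma_power_eq_iff using False by (simp add: dvd_eq_mod_eq_0)
  ultimately show ?thesis using False by auto
qed

lemma ind_divide_mod:
  assumes "e dvd q - 1" "x \<noteq> 0" "y \<noteq> 0"
  shows "(ind (x / y) + ind y) mod e = ind x mod e"
  using ind_mult_mod[OF assms(1), of "x / y" y] assms by simp

lemma ind_divide_cong:
  assumes "e dvd q - 1" "x \<noteq> 0" "y \<noteq> 0" "ind y mod e = 0"
  shows "ind (x / y) mod e = ind x mod e"
  using ind_mult_cong[OF assms(1) _ assms(3,4), of "x / y"] assms(2,3) by simp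

end

section \<open>The cubic Jacobi sum\<close>

locale norm_form_field = primitive_root_field \<gamma> q
  for \<gamma> :: "'a::{finite,field}" and q :: nat +
  fixes a :: int and l :: nat
  assumes q_form: "int q = 1 + 3 * a\<^sup>2"
    and cubic: "\<exists>z::'a. z \<noteq> 0 \<and> 2 = z ^ 3"
    and l_eq: "l = (q - 1) div 6"
begin

section \<open>Parity and sixth powers\<close>

lemma two_nonzero: "(2 :: 'a) \<noteq> 0"
  using cubic by auto

lemma odd_CHAR: "odd CHAR('a)"
proof
  assume "even CHAR('a)"
  hence "CHAR('a) = 2" using prime_CHAR_finite_field[where 'a = 'a] primes_dvd_imp_eq two_is_prime_nat by metis
  thus False using of_nat_CHAR[where 'a = 'a] two_nonzero by simp
qed

lemma even_a: "even a"
proof -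
  obtain f where "q = CHAR('a) ^ f" using card_finite_field_prime_power[where 'a = 'a] q_eq by metis
  hence "odd (int q)" using odd_CHAR by simp
  thus ?thesis using q_form by simp
qed

text \<open>With \<open>a = 2 * b\<close> one has \<open>q - 1 = 12 * b^2\<close> and
  \<open>l = 2 * b^2\<close>. The evenness of \<open>l\<close> makes \<open>- 1\<close> a sixth
  power.\<close>

lemma q_minus_1: "q - 1 = 6 * l" and even_l: "even l" and l_pos: "l > 0"
proof -
  obtain b where b: "a = 2 * b" using even_a by (elim evenE)
  have "int (q - 1) = 6 * (2 * b\<^sup>2)" using q_form q_gt_1 by (simp add: of_nat_diff b power_mult_distrib)
  hence "q - 1 = 6 * (2 * nat (b\<^sup>2))" by (simp add: nat_eq_iff nat_mult_distrib flip: of_nat_eq_iff)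
  thus "q - 1 = 6 * l" "even l" by (simp_all add: l_eq)
  thus "l > 0" using q_gt_1 by (cases l) auto
qed

lemma dvd_q_minus_1: "6 dvd q - 1" "3 dvd q - 1" "2 dvd q - 1"
proof -
  have "q - 1 = 3 * (2 * l)" "q - 1 = 2 * (3 * l)" using q_minus_1 by simp_all
  thus "6 dvd q - 1" "3 dvd q - 1" "2 dvd q - 1" using q_minus_1 by (metis dvd_triv_left)+
qed

lemma minus_one: "- 1 = \<gamma> ^ (6 * (l div 2))"
proof -
  have "6 * (l div 2) = 3 * l" using even_l by auto
  moreover have "q - 1 = 2 * (3 * l)" using q_minus_1 by simp
  ultimately show ?thesis using minus_one_eq_gamma_power by metis
qed

lemma sixth_root_q_minus_1:
  fixes \<zeta> :: complex
  shows "\<zeta> ^ 6 = 1 \<Longrightarrow> \<zeta> ^ (q - 1) = 1"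
  unfolding q_minus_1 power_mult by simp

lemma mchar_minus_one: "\<zeta> ^ 6 = 1 \<Longrightarrow> mchar \<zeta> (- 1) = 1"
  unfolding minus_one using sixth_root_q_minus_1 by (subst mchar_gamma_power) (simp_all add: power_mult)

text \<open>If \<open>2 = z ^ 3\<close> then \<open>4 = z ^ 6\<close>. In this form the cubic
  residuacity of 2 enters the character computations.\<close>

lemma four_sixth_power: obtains k where "4 = \<gamma> ^ (6 * k)"
proof -
  obtain z :: 'a where z: "z \<noteq> 0" "2 = z ^ 3" using cubic by blast
  have "(4 :: 'a) = 2 * 2" by simp
  also have "\<dots> = z ^ 6" unfolding z(2) by (simp flip: power_add)
  also have "\<dots> = \<gamma> ^ (6 * ind z)" using gamma_power_ind[OF z(1)] by (metis mult.commute power_mult)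
  finally show ?thesis using that by blast
qed

lemma mchar_four: "\<zeta> ^ 6 = 1 \<Longrightarrow> mchar \<zeta> 4 = 1"
  using four_sixth_power sixth_root_q_minus_1 by (metis mchar_gamma_power power_mult power_one)

section \<open>Coefficients of the cubic Jacobi sum\<close>

text \<open>These are the coefficients of \<open>jacobi_sum \<omega> \<omega>\<close> in the powers
  of \<open>\<omega>\<close>; the points 0 and 1 contribute nothing to that sum.\<close>

definition cubic_count :: "nat \<Rightarrow> nat" where
  "cubic_count i = card {x \<in> UNIV - {0, 1}. ind (x * (1 - x)) mod 3 = i}"

lemma jacobi_sum_omega: "jacobi_sum \<omega> \<omega> =
    of_nat (cubic_count 0) + of_nat (cubic_count 1) * \<omega> + of_nat (cubic_count 2) * \<omega>\<^sup>2"
proof -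
  have "jacobi_sum \<omega> \<omega> = (\<Sum>x\<in>UNIV - {0, 1}. mchar \<omega> (x * (1 - x)))"
    unfolding jacobi_sum_def mchar_mult[OF sixth_root_q_minus_1[OF sixth_roots[of \<omega>]], simplified]
    by (rule sum.mono_neutral_right) auto
  also have "\<dots> = (\<Sum>x\<in>UNIV - {0, 1}. \<omega> ^ ind (x * (1 - x)))"
    by (rule sum.cong) (auto simp: mchar_def)
  finally show ?thesis
    by (simp add: sum_cube_root_power[OF _ omega_cube] cubic_count_def)
qed

lemma cubic_count_sum: "cubic_count 0 + cubic_count 1 + cubic_count 2 = q - 2"
proof -
  have "(\<Sum>x\<in>UNIV - {0, 1 :: 'a}. (1 :: int) ^ ind (x * (1 - x))) =
      int (cubic_count 0 + cubic_count 1 + cubic_count 2)"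
    unfolding cubic_count_def by (subst sum_cube_root_power) simp_all
  moreover have "(\<Sum>x\<in>UNIV - {0, 1 :: 'a}. (1 :: int) ^ ind (x * (1 - x))) = int (q - 2)"
    by (simp add: q_eq card_Diff_subset)
  ultimately show ?thesis by linarith
qed

text \<open>The involution \<open>1 - x\<close> preserves \<open>x * (1 - x)\<close>. A fixed point
  has \<open>4 * (x * (1 - x)) = 1\<close> with 4 a sixth power, so it lies in cubic class
  0.\<close>

lemma even_cubic_count:
  assumes "i = 1 \<or> i = 2"
  shows "even (cubic_count i)"
  unfolding cubic_count_def
proof (rule even_card_if_involution[where g = "\<lambda>x. 1 - x"], simp, goal_cases)
  case (1 x)
  have "1 - x \<noteq> x"
  proof
    assume e: "1 - x = x"
    have "4 * (x * (1 - x)) = (x + x) * (x + x)" unfolding e by (simp add: algebra_simps)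
    also have "x + x = 1" using e by (metis diff_add_cancel)
    finally have "4 * (x * (1 - x)) = 1" by simp
    moreover obtain k where k: "(4 :: 'a) = \<gamma> ^ (6 * k)" using four_sixth_power by blast
    ultimately have "ind (x * (1 - x) * \<gamma> ^ (6 * k)) mod 3 = 0"
      by (simp add: mult.commute ind_one_mod[OF dvd_q_minus_1(2)])
    moreover have "ind (\<gamma> ^ (6 * k)) mod 3 = 0"
      unfolding ind_gamma_power_mod[OF dvd_q_minus_1(2)] by simp
    ultimately have "ind (x * (1 - x)) mod 3 = 0"
      using ind_mult_cong[OF dvd_q_minus_1(2), of "x * (1 - x)" "\<gamma> ^ (6 * k)"] 1 by simp
    thus False using 1 assms by auto
  qed
  thus ?case using 1 by (auto simp: mult.commute)
qed

text \<open>The map \<open>1 / (1 - x)\<close> has order 3 and changes \<open>x * (1 - x)\<close> by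
  a cube only. A fixed point has \<open>x * (1 - x) = 1\<close>, hence lies in cubic class
  0.\<close>

lemma three_dvd_cubic_count:
  assumes "i = 1 \<or> i = 2"
  shows "3 dvd cubic_count i"
  unfolding cubic_count_def
proof (rule three_dvd_card_if_order_3[where g = "\<lambda>x. 1 / (1 - x)"], simp, goal_cases)
  case (1 x)
  hence x: "x \<noteq> 0" "x \<noteq> 1" "1 - x \<noteq> 0" and ix: "ind (x * (1 - x)) mod 3 = i" by auto
  have c: "1 - 1 / (1 - x) = - x / (1 - x)" using x by (simp add: divide_simps)
  have "1 / (1 - x) \<noteq> x"
  proof
    assume "1 / (1 - x) = x"
    hence "x * (1 - x) = 1" using x by (simp add: divide_simps)
    thus False using ix assms ind_one_mod[OF dvd_q_minus_1(2)] by auto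
  qed
  moreover have "1 / (1 - 1 / (1 - 1 / (1 - x))) = x"
    unfolding c using x by (simp add: divide_simps)
  moreover have "1 / (1 - x) \<noteq> 0" "1 / (1 - x) \<noteq> 1" using x by (auto simp: divide_simps)
  moreover have "ind (1 / (1 - x) * (1 - 1 / (1 - x))) mod 3 = i"
  proof -
    define y where "y = 1 / (1 - x) * (1 - 1 / (1 - x))"
    have y0: "y \<noteq> 0" unfolding y_def c using x by simp
    \<comment> \<open>The ratio of the old value of \<open>x * (1 - x)\<close> to the new one
      \<open>y\<close>; it is a cube since \<open>- 1\<close> is.\<close>
    define t where "t = (1 - x) ^ 3 * (- 1)"
    have t0: "t \<noteq> 0" using x by (simp add: t_def)
    have "t = \<gamma> ^ (3 * (ind (1 - x) + 2 * (l div 2)))"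
    proof -
      have "t = (\<gamma> ^ ind (1 - x)) ^ 3 * \<gamma> ^ (6 * (l div 2))"
        unfolding t_def minus_one by (simp only: gamma_power_ind[OF x(3)])
      thus ?thesis by (simp add: power_add algebra_simps flip: power_mult)
    qed
    hence "ind t mod 3 = 0" using ind_gamma_power_mod[OF dvd_q_minus_1(2)] by simp
    hence "ind (y * t) mod 3 = ind y mod 3" using ind_mult_cong[OF dvd_q_minus_1(2) y0 t0] by simp
    moreover have "y * t = x * (1 - x)"
      unfolding y_def t_def c using x by (simp add: power3_eq_cube)
    ultimately show ?thesis using ix by (simp add: y_def)
  qed
  ultimately show ?case by blast
qed

text \<open>Otherwise the three counts agree in the field, so the sum of
  \<open>(x * (1 - x)) ^ (4 * l)\<close> vanishes there. Binomial expansion and the power sums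
  evaluate it as minus a central binomial coefficient prime to the characteristic.\<close>

lemma CHAR_not_dvd_cubic_counts:
  "\<not> (int CHAR('a) dvd int (cubic_count 0) - int (cubic_count 2) \<and>
      int CHAR('a) dvd int (cubic_count 1) - int (cubic_count 2))"
proof
  assume dvd: "int CHAR('a) dvd int (cubic_count 0) - int (cubic_count 2) \<and>
      int CHAR('a) dvd int (cubic_count 1) - int (cubic_count 2)"
  have "of_int (int (cubic_count 0) - int (cubic_count 2)) = (0 :: 'a)"
    "of_int (int (cubic_count 1) - int (cubic_count 2)) = (0 :: 'a)"
    unfolding of_int_eq_0_iff_char_dvd using dvd by auto
  hence eq: "of_nat (cubic_count 0) = (of_nat (cubic_count 2) :: 'a)"
    "of_nat (cubic_count 1) = (of_nat (cubic_count 2) :: 'a)" by simp_all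
  \<comment> \<open>A primitive cube root of unity in the field. With exponent \<open>2 * l\<close>
    instead, the expansion would reach only the powers \<open>2 * l\<close> to \<open>4 * l\<close>,
    none divisible by \<open>q - 1\<close>, and its sum would be trivially 0.\<close>
  define \<beta> where "\<beta> = \<gamma> ^ (4 * l)"
  have "\<beta> ^ 3 = \<gamma> ^ ((q - 1) * 2)" unfolding q_minus_1 \<beta>_def by (simp add: mult.commute flip: power_mult)
  also have "\<dots> = 1" unfolding power_mult power_q_minus_1[OF gamma_nonzero] by simp
  finally have \<beta>3: "\<beta> ^ 3 = 1" .
  have "\<gamma> ^ (4 * l) \<noteq> \<gamma> ^ 0" unfolding gamma_power_eq_iff q_minus_1 using l_pos by simp
  hence "\<beta> \<noteq> 1" by (simp add: \<beta>_def)
  moreover have "(\<beta> - 1) * (1 + \<beta> + \<beta>\<^sup>2) = \<beta> ^ 3 - 1"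
    by (simp add: algebra_simps power2_eq_square power3_eq_cube)
  ultimately have \<beta>: "1 + \<beta> + \<beta>\<^sup>2 = 0" using \<beta>3 by simp
  have "(\<Sum>x\<in>UNIV. (x * (1 - x)) ^ (4 * l)) = (\<Sum>x\<in>UNIV - {0, 1}. \<beta> ^ ind (x * (1 - x)))"
  proof (rule sum.mono_neutral_cong_right)
    fix x :: 'a assume "x \<in> UNIV - {0, 1}"
    hence "x * (1 - x) = \<gamma> ^ ind (x * (1 - x))" by (simp add: gamma_power_ind)
    thus "(x * (1 - x)) ^ (4 * l) = \<beta> ^ ind (x * (1 - x))"
      unfolding \<beta>_def by (metis mult.commute power_mult)
  qed (use l_pos in auto)
  also have "\<dots> = of_nat (cubic_count 2) * (1 + \<beta> + \<beta>\<^sup>2)"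
    unfolding sum_cube_root_power[OF finite \<beta>3]
    unfolding cubic_count_def[symmetric] eq by (simp add: algebra_simps)
  also have "\<dots> = 0" by (simp add: \<beta>)
  finally have zero: "(\<Sum>x\<in>UNIV. ((x :: 'a) * (1 - x)) ^ (4 * l)) = 0" .
  have "(\<Sum>x\<in>UNIV. ((x :: 'a) * (1 - x)) ^ (4 * l))
      = (\<Sum>x\<in>UNIV. \<Sum>j\<le>4 * l. of_nat (4 * l choose j) * (- 1) ^ j * x ^ (4 * l + j))"
  proof (rule sum.cong[OF refl])
    fix x :: 'a
    have "(1 - x) ^ (4 * l) = (\<Sum>j\<le>4 * l. of_nat (4 * l choose j) * (- x) ^ j)"
      using binomial_ring[of "- x" 1 "4 * l"] by simp
    thus "(x * (1 - x)) ^ (4 * l) = (\<Sum>j\<le>4 * l. of_nat (4 * l choose j) * (- 1) ^ j * x ^ (4 * l + j))"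
      by (simp add: power_mult_distrib sum_distrib_left power_add power_minus[of x] mult_ac)
  qed
  also have "\<dots> = (\<Sum>j\<le>4 * l. of_nat (4 * l choose j) * (- 1) ^ j * (\<Sum>x\<in>UNIV. (x :: 'a) ^ (4 * l + j)))"
    by (subst sum.swap) (simp add: sum_distrib_left)
  \<comment> \<open>Among the exponents from \<open>4 * l\<close> to \<open>8 * l\<close>, only
    \<open>6 * l\<close> is a multiple of \<open>q - 1\<close>.\<close>
  also have "\<dots> = (\<Sum>j\<in>{2 * l}. - of_nat (4 * l choose j))"
  proof (rule sum.mono_neutral_cong_right)
    show "\<forall>j\<in>{..4 * l} - {2 * l}. of_nat (4 * l choose j) * (- 1) ^ j * (\<Sum>x\<in>UNIV. (x :: 'a) ^ (4 * l + j)) = 0"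
    proof
      fix j assume j: "j \<in> {..4 * l} - {2 * l}"
      have "\<not> q - 1 dvd 4 * l + j"
      proof
        assume "q - 1 dvd 4 * l + j"
        then obtain m where m: "4 * l + j = 6 * l * m" unfolding q_minus_1 by auto
        have "m \<noteq> 0" using m l_pos by (cases m) auto
        moreover have "m < 2"
        proof (rule ccontr)
          assume "\<not> m < 2"
          hence "6 * l * 2 \<le> 6 * l * m" by (intro mult_left_mono) auto
          moreover have "j \<le> 4 * l" using j by simp
          ultimately show False using m l_pos by linarith
        qed
        ultimately have "m = 1" by simp
        thus False using m j by simp
      qed
      thus "of_nat (4 * l choose j) * (- 1) ^ j * (\<Sum>x\<in>UNIV. (x :: 'a) ^ (4 * l + j)) = 0"
        using l_pos by (simp add: sum_powers)
    qed
    fix j assume "j \<in> {2 * l}"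
    hence j: "j = 2 * l" by simp
    have "q - 1 dvd 4 * l + j" unfolding q_minus_1 j by simp
    hence "(\<Sum>x\<in>UNIV. (x :: 'a) ^ (4 * l + j)) = - 1" using sum_powers[of "4 * l + j"] l_pos by simp
    thus "of_nat (4 * l choose j) * (- 1) ^ j * (\<Sum>x\<in>UNIV. (x :: 'a) ^ (4 * l + j)) = - of_nat (4 * l choose j)"
      by (simp add: j)
  qed auto
  finally have "of_nat (4 * l choose (2 * l)) = (0 :: 'a)" using zero by simp
  hence "CHAR('a) dvd (2 * (2 * l) choose (2 * l))" by (simp add: of_nat_eq_0_iff_char_dvd)
  moreover obtain f where f: "f > 0" "q = CHAR('a) ^ f"
    using card_finite_field_prime_power[where 'a = 'a] q_eq by metis
  moreover have "CHAR('a) mod 3 = 1"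
  proof (rule prime_dvd_norm_form_mod_3[OF prime_CHAR_finite_field odd_CHAR even_a])
    show "int CHAR('a) dvd 1 + 3 * a\<^sup>2" unfolding q_form[symmetric] f(2) using f(1) by simp
  qed
  moreover have "3 * (2 * l) + 1 = q" using q_minus_1 q_gt_1 by simp
  ultimately show False using prime_not_dvd_central_binomial[OF prime_CHAR_finite_field] by metis
qed

section \<open>Evaluation of the Jacobi sums\<close>

lemma omega_root: "\<omega> ^ (q - 1) = 1" "(- \<omega>) ^ (q - 1) = 1" "(- 1 :: complex) ^ (q - 1) = 1"
  "(\<omega>\<^sup>2) ^ (q - 1) = 1" "(- (\<omega>\<^sup>2)) ^ (q - 1) = 1"
  using sixth_roots by (simp_all only: sixth_root_q_minus_1 insert_iff simp_thms)

text \<open>Unique representation of the norm \<open>q\<close> leaves 1 and \<open>- 1\<close> for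
  the real part, and its residue modulo 3 selects the sign.\<close>

lemma Re_jacobi_sum_omega: "Re (jacobi_sum \<omega> \<omega>) = - 1"
proof -
  define n0 n1 n2 where "n0 = int (cubic_count 0)" and "n1 = int (cubic_count 1)" and "n2 = int (cubic_count 2)"
  have "even (n1 - n2)" using even_cubic_count[of 1] even_cubic_count[of 2] by (simp add: n1_def n2_def)
  then obtain M where M: "n1 - n2 = 2 * M" by (elim evenE)
  define L where "L = n0 - n2 - M"
  have J: "jacobi_sum \<omega> \<omega> = Complex (real_of_int L) (real_of_int M * sqrt 3)"
  proof -
    have "jacobi_sum \<omega> \<omega> = of_real (real_of_int n0) + of_real (real_of_int n1) * \<omega> + of_real (real_of_int n2) * \<omega>\<^sup>2"
      by (simp add: jacobi_sum_omega n0_def n1_def n2_def)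
    also have "\<dots> = Complex (real_of_int n0 - (real_of_int n1 + real_of_int n2) / 2)
        ((real_of_int n1 - real_of_int n2) / 2 * sqrt 3)"
      by (rule omega_combination)
    also have "real_of_int n1 = real_of_int n2 + 2 * real_of_int M" using M by linarith
    finally show ?thesis by (simp add: L_def field_simps)
  qed
  \<comment> \<open>Conjugation inverts \<open>\<omega>\<close>, so this is the norm formula,
    applicable because \<open>\<omega> * \<omega> \<noteq> 1\<close>.\<close>
  have "jacobi_sum \<omega> \<omega> * cnj (jacobi_sum \<omega> \<omega>) = of_nat q"
    unfolding cnj_jacobi_sum cnj_omega unfolding inverse_omega[symmetric]
    using omega_nontrivial by (intro jacobi_sum_norm omega_root) (simp_all add: power2_eq_square)
  hence "real q = real_of_int L ^ 2 + 3 * real_of_int M ^ 2"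
    unfolding J by (simp add: complex_eq_iff power2_eq_square algebra_simps)
  hence "real_of_int (int q) = real_of_int (L\<^sup>2 + 3 * M\<^sup>2)" by simp
  hence norm: "int q = L\<^sup>2 + 3 * M\<^sup>2" by linarith
  obtain f where f: "f > 0" "q = CHAR('a) ^ f"
    using card_finite_field_prime_power[where 'a = 'a] q_eq by metis
  have "\<not> (int CHAR('a) dvd L \<and> int CHAR('a) dvd M)"
  proof
    assume *: "int CHAR('a) dvd L \<and> int CHAR('a) dvd M"
    hence "int CHAR('a) dvd L + M" "int CHAR('a) dvd 2 * M" by auto
    hence "int CHAR('a) dvd n0 - n2 \<and> int CHAR('a) dvd n1 - n2" using M by (simp add: L_def)
    thus False using CHAR_not_dvd_cubic_counts by (simp add: n0_def n1_def n2_def)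
  qed
  hence "L\<^sup>2 = 1"
    using norm_form_unique[of "CHAR('a)" f a L M, OF prime_CHAR_finite_field odd_CHAR] f norm q_form by simp
  hence "L = 1 \<or> L = - 1" by (simp add: power2_eq_1_iff)
  \<comment> \<open>Since 3 divides \<open>n1\<close>, \<open>n2\<close> and \<open>M\<close>, the
    number \<open>L\<close> is congruent to the sum of the counts, which is
    \<open>q - 2 = 3 * a^2 - 1\<close>.\<close>
  moreover have "L mod 3 = 2"
  proof -
    have "3 dvd n1" "3 dvd n2" using three_dvd_cubic_count[of 1] three_dvd_cubic_count[of 2]
      unfolding n1_def n2_def by (metis int_dvd_int_iff of_nat_numeral)+
    then obtain k1 k2 where k: "n1 = 3 * k1" "n2 = 3 * k2" by (elim dvdE)
    have "2 * M = 3 * (k1 - k2)" using M k by simp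
    hence "3 dvd 2 * M" by simp
    hence "3 dvd M" by (simp add: coprime_dvd_mult_right_iff)
    then obtain k3 where k3: "M = 3 * k3" by (elim dvdE)
    have "n0 + n1 + n2 = int (q - 2)"
      unfolding n0_def n1_def n2_def cubic_count_sum[symmetric] by simp
    also have "\<dots> = 3 * a\<^sup>2 - 1" using q_form q_gt_1 by (simp add: of_nat_diff)
    finally have "L = 2 + 3 * (a\<^sup>2 - 1 - k1 - 2 * k2 - k3)" using k k3 by (simp add: L_def)
    moreover have "(2 + 3 * K) mod 3 = 2" for K :: int by presburger
    ultimately show ?thesis by metis
  qed
  ultimately have "L = - 1" by auto
  thus ?thesis using J by simp
qed

text \<open>Reflection and completing the square introduce no extra factors, as all sextic
  characters are 1 at \<open>- 1\<close> and at 4.\<close>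

lemma jacobi_sum_relations:
  "jacobi_sum (- 1) \<omega> = jacobi_sum \<omega> \<omega>"
  "jacobi_sum (- (\<omega>\<^sup>2)) \<omega> = jacobi_sum \<omega> \<omega>"
  "jacobi_sum (- \<omega>) \<omega> = cnj (jacobi_sum \<omega> \<omega>)"
  "jacobi_sum (\<omega>\<^sup>2) \<omega> = - 1"
  "jacobi_sum 1 \<omega> = - 1"
proof -
  have half: "q - 1 = 2 * (3 * l)" using q_minus_1 by simp
  have neg: "mchar \<zeta> (- 1) = 1" "mchar \<zeta> 4 = 1" if "\<zeta> \<in> {1, \<omega>, \<omega>\<^sup>2, - 1, - \<omega>, - (\<omega>\<^sup>2)}" for \<zeta>
    using that by (auto intro!: mchar_minus_one mchar_four sixth_roots)
  show a: "jacobi_sum (- 1) \<omega> = jacobi_sum \<omega> \<omega>"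
    using jacobi_sum_diag[OF half two_nonzero omega_root(1)] omega_nontrivial neg(2) by simp
  have i1: "inverse (\<omega> * - (\<omega>\<^sup>2)) = - 1" using omega_cube by (simp add: power2_eq_square power3_eq_cube mult.assoc)
  have "jacobi_sum (- (\<omega>\<^sup>2)) \<omega> = jacobi_sum \<omega> (- (\<omega>\<^sup>2))" by (rule jacobi_sum_commute)
  also have "\<dots> = jacobi_sum \<omega> (- 1)"
    using jacobi_sum_reflect[OF omega_root(1) omega_root(5)] neg(1) unfolding i1 by simp
  also have "\<dots> = jacobi_sum \<omega> \<omega>" using a by (simp add: jacobi_sum_commute)
  finally show "jacobi_sum (- (\<omega>\<^sup>2)) \<omega> = jacobi_sum \<omega> \<omega>" .
  have i2: "inverse (- \<omega> * \<omega>) = - \<omega>"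
    by (rule inverse_unique) (use omega_cube in \<open>simp add: power3_eq_cube mult.assoc\<close>)
  have i3: "inverse (- 1 * - \<omega>) = \<omega>\<^sup>2" by (simp add: inverse_omega)
  \<comment> \<open>The pair \<open>(- \<omega>, \<omega>)\<close> is reflected, reduced by
    completing the square, and reflected again until both entries are conjugates of
    \<open>- 1\<close> and \<open>\<omega>\<close>.\<close>
  have "jacobi_sum (- \<omega>) \<omega> = jacobi_sum (- \<omega>) (- \<omega>)"
    using jacobi_sum_reflect[OF omega_root(2) omega_root(1)] neg(1) unfolding i2 by simp
  also have "\<dots> = jacobi_sum (- 1) (- \<omega>)"
    using jacobi_sum_diag[OF half two_nonzero omega_root(2)] omega_nontrivial neg(2)
    by (simp add: minus_equation_iff)
  also have "\<dots> = jacobi_sum (- 1) (\<omega>\<^sup>2)"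
    using jacobi_sum_reflect[OF omega_root(3) omega_root(2)] neg(1) unfolding i3 by simp
  also have "\<dots> = cnj (jacobi_sum (- 1) \<omega>)" by (simp add: cnj_jacobi_sum cnj_omega)
  finally show "jacobi_sum (- \<omega>) \<omega> = cnj (jacobi_sum \<omega> \<omega>)" by (simp add: a)
  show "jacobi_sum (\<omega>\<^sup>2) \<omega> = - 1"
    using jacobi_sum_inverse[OF omega_root(1) omega_nontrivial(1)] neg(1)
    by (simp add: inverse_omega jacobi_sum_commute)
  show "jacobi_sum 1 \<omega> = - 1" by (rule jacobi_sum_1_left[OF omega_root(1) omega_nontrivial(1)])
qed

section \<open>Differences between classes of order six\<close>

abbreviation D :: "nat \<Rightarrow> 'a set" where
  "D \<equiv> cyclo_class \<gamma> 6"

lemma D_iff: "i < 6 \<Longrightarrow> x \<in> D i \<longleftrightarrow> x \<noteq> 0 \<and> ind x mod 6 = i"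
  by (simp add: cyclo_class_eq[OF dvd_q_minus_1(1)])

lemma card_D: "i < 6 \<Longrightarrow> card (D i) = l"
  by (rule card_cyclo_class[OF q_minus_1])

lemma D_mult_gamma_power [simp]: "i < 6 \<Longrightarrow> x * \<gamma> ^ (6 * k) \<in> D i \<longleftrightarrow> x \<in> D i"
  using ind_mult_mod[OF dvd_q_minus_1(1), of x "\<gamma> ^ (6 * k)"]
    ind_gamma_power_mod[OF dvd_q_minus_1(1), of "6 * k"]
  by (cases "x = 0") (auto simp: D_iff intro: ind_mult_cong[OF dvd_q_minus_1(1), THEN trans])

lemma D_uminus [simp]: "i < 6 \<Longrightarrow> - x \<in> D i \<longleftrightarrow> x \<in> D i"
  using D_mult_gamma_power[of i x "l div 2"] minus_one by (metis mult_minus1_right)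

text \<open>Expanding the indicator of \<open>D 3\<close> leaves six Jacobi sums, which add up to
  \<open>- 2 - 2 Re J\<close> with \<open>J = jacobi_sum \<omega> \<omega>\<close>.\<close>

lemma sum_mchar_shifted_D3: "(\<Sum>v\<in>D 3. mchar \<omega> (1 + v)) = 0"
proof -
  have ind6: "mchar 1 v + mchar \<omega> v + mchar (\<omega>\<^sup>2) v - mchar (- 1) v - mchar (- \<omega>) v - mchar (- (\<omega>\<^sup>2)) v
      = 6 * of_bool (v \<in> D 3)" for v
    using sixth_root_indicator[of "ind v"] by (simp add: mchar_def D_iff)
  \<comment> \<open>\<open>D 3 = - D 3\<close> permits the change of sign that produces the argument
    \<open>1 - v\<close> of Jacobi sums.\<close>
  have "(\<Sum>v\<in>D 3. mchar \<omega> (1 + v)) = (\<Sum>v\<in>D 3. mchar \<omega> (1 - v))"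
    by (rule sum.reindex_bij_witness[where i = uminus and j = uminus]) auto
  also have "\<dots> = (\<Sum>v\<in>UNIV. of_bool (v \<in> D 3) * mchar \<omega> (1 - v))"
    by (rule sum.mono_neutral_cong_left) auto
  also have "6 * \<dots> = (\<Sum>v\<in>UNIV. (6 * of_bool (v \<in> D 3)) * mchar \<omega> (1 - v))"
    by (simp only: sum_distrib_left mult.assoc)
  also have "\<dots> = jacobi_sum 1 \<omega> + jacobi_sum \<omega> \<omega> + jacobi_sum (\<omega>\<^sup>2) \<omega>
      - jacobi_sum (- 1) \<omega> - jacobi_sum (- \<omega>) \<omega> - jacobi_sum (- (\<omega>\<^sup>2)) \<omega>"
    unfolding ind6[symmetric] jacobi_sum_def
    by (simp add: algebra_simps sum.distrib sum_subtractf)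
  also have "\<dots> = - 2 - (jacobi_sum \<omega> \<omega> + cnj (jacobi_sum \<omega> \<omega>))"
    by (simp add: jacobi_sum_relations)
  also have "\<dots> = 0" unfolding complex_add_cnj Re_jacobi_sum_omega by simp
  finally show ?thesis by simp
qed

lemma one_plus_D3_nonzero: "v \<in> D 3 \<Longrightarrow> 1 + v \<noteq> 0"
proof
  assume v: "v \<in> D 3" "1 + v = 0"
  hence "v = - 1" by (simp add: add_eq_0_iff)
  hence "1 \<in> D 3" using v by simp
  thus False using ind_one_mod[OF dvd_q_minus_1(1)] by (simp add: D_iff)
qed

text \<open>A vanishing real combination of 1, \<open>\<omega>\<close> and \<open>\<omega>^2\<close>
  has equal coefficients, so the three cubic classes are hit equally often.\<close>

lemma card_D3_shifted_cubic:
  assumes "i < 3"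
  shows "3 * card {v \<in> D 3. ind (1 + v) mod 3 = i} = l"
proof -
  define W where "W i = card {v \<in> D 3. ind (1 + v) mod 3 = i}" for i
  have "(\<Sum>v\<in>D 3. mchar \<omega> (1 + v)) = (\<Sum>v\<in>D 3. \<omega> ^ ind (1 + v))"
    by (rule sum.cong) (auto simp: mchar_def dest: one_plus_D3_nonzero)
  hence "of_real (W 0) + of_real (W 1) * \<omega> + of_real (W 2) * \<omega>\<^sup>2 = 0"
    unfolding sum_mchar_shifted_D3 sum_cube_root_power[OF finite omega_cube] W_def by simp
  hence "W 0 = W 1" "W 0 = W 2"
    unfolding omega_combination by (auto simp: complex_eq_iff)
  moreover have "int (card (D 3)) = int (W 0 + W 1 + W 2)"
    using sum_cube_root_power[of "D 3" "1 :: int" "\<lambda>v. ind (1 + v)"] by (simp add: W_def)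
  moreover have "i = 0 \<or> i = 1 \<or> i = 2" using assms by auto
  ultimately show ?thesis by (auto simp: card_D W_def)
qed

text \<open>Inversion preserves \<open>D 3\<close>, and \<open>1 + 1 / v = (1 + v) / v\<close>
  shifts the class of \<open>1 + v\<close> by 3, so each cubic class splits evenly. The factor 6
  avoids presupposing that 6 divides \<open>l\<close>.\<close>

lemma card_D3_shifted:
  assumes "j < 6"
  shows "6 * card {v \<in> D 3. ind (1 + v) mod 6 = j} = l"
proof -
  define w where "w j = card {v \<in> D 3. ind (1 + v) mod 6 = j}" for j
  have swap: "inverse v \<in> D 3 \<and> ind (1 + inverse v) mod 6 = (j + 3) mod 6"
    if v: "v \<in> D 3" "ind (1 + v) mod 6 = j" for v j
  proof -
    have v0: "v \<noteq> 0" "ind v mod 6 = 3" using v(1) by (auto simp: D_iff)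
    have "(ind (inverse v) + ind v) mod 6 = 0"
      using ind_divide_mod[OF dvd_q_minus_1(1), of 1 v] v0
      by (simp add: ind_one_mod[OF dvd_q_minus_1(1)] divide_inverse)
    moreover have "m mod 6 = 3" if "(m + n) mod 6 = 0" "n mod 6 = 3" for m n :: nat
      using that by presburger
    ultimately have iv: "ind (inverse v) mod 6 = 3" using v0(2) by metis
    have "1 + inverse v = (1 + v) * inverse v" using v0 by (simp add: field_simps)
    hence "ind (1 + inverse v) mod 6 = (ind (1 + v) + ind (inverse v)) mod 6"
      using ind_mult_mod[OF dvd_q_minus_1(1), of "1 + v" "inverse v"] one_plus_D3_nonzero[OF v(1)] v0 by simp
    also have "\<dots> = (ind (1 + v) mod 6 + ind (inverse v) mod 6) mod 6" by (simp only: mod_add_eq)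
    finally show ?thesis using iv v(2) v0 by (simp add: D_iff)
  qed
  have eq: "w i = w (i + 3)" if "i < 3" for i
    unfolding w_def
  proof (rule bij_betw_same_card[of inverse], rule bij_betw_byWitness[where f' = inverse])
    show "inverse ` {v \<in> D 3. ind (1 + v) mod 6 = i} \<subseteq> {v \<in> D 3. ind (1 + v) mod 6 = i + 3}"
      using swap[of _ i] that by auto
    show "inverse ` {v \<in> D 3. ind (1 + v) mod 6 = i + 3} \<subseteq> {v \<in> D 3. ind (1 + v) mod 6 = i}"
      using swap[of _ "i + 3"] that by auto
  qed auto
  have "card {v \<in> D 3. ind (1 + v) mod 3 = i} = w i + w (i + 3)" if "i < 3" for i
  proof -
    have "n mod 3 = i \<longleftrightarrow> n mod 6 = i \<or> n mod 6 = i + 3" for n :: nat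
    proof -
      have "n mod 3 = n mod 6 mod 3" by (simp add: mod_mod_cancel)
      moreover have "n mod 6 \<in> {0, 1, 2, 3, 4, 5}" by auto
      moreover have "i \<in> {0, 1, 2}" using that by auto
      ultimately show ?thesis by auto
    qed
    hence "{v \<in> D 3. ind (1 + v) mod 3 = i} =
        {v \<in> D 3. ind (1 + v) mod 6 = i} \<union> {v \<in> D 3. ind (1 + v) mod 6 = i + 3}" by auto
    thus ?thesis unfolding w_def by (simp add: card_Un_disjoint disjoint_iff)
  qed
  hence "6 * w i = l \<and> 6 * w (i + 3) = l" if "i < 3" for i
    using card_D3_shifted_cubic[OF that] eq[OF that] that by simp
  from this[of "j mod 3"] have "6 * w (j mod 3) = l \<and> 6 * w (j mod 3 + 3) = l" by simp
  moreover have "j = j mod 3 \<or> j = j mod 3 + 3" using assms by presburger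
  ultimately show ?thesis unfolding w_def by metis
qed

text \<open>With \<open>u = \<delta> - v\<close> in \<open>D 0\<close>, the quotient
  \<open>v / u\<close> stays in \<open>D 3\<close> and \<open>1 + v / u = \<delta> / u\<close> lies
  in the class of \<open>\<delta>\<close>.\<close>

lemma card_D3_minus_D0:
  assumes \<delta>: "\<delta> \<noteq> 0"
  shows "6 * card {v \<in> D 3. v - \<delta> \<in> D 0} = l"
proof -
  note div0 = ind_divide_cong[OF dvd_q_minus_1(1)]
  let ?A = "{v \<in> D 3. v - \<delta> \<in> D 0}" and ?B = "{v \<in> D 3. ind (1 + v) mod 6 = ind \<delta> mod 6}"
  have "card ?A = card ?B"
  proof (rule bij_betw_same_card[of "\<lambda>v. v / (\<delta> - v)"],
      rule bij_betw_byWitness[where f' = "\<lambda>v. v * (\<delta> / (1 + v))"])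
    have A: "\<delta> - v \<noteq> 0" "ind (\<delta> - v) mod 6 = 0" "v \<noteq> 0" "ind v mod 6 = 3" if "v \<in> ?A" for v
    proof -
      have "- (v - \<delta>) \<in> D 0" using that by (subst D_uminus) auto
      thus "\<delta> - v \<noteq> 0" "ind (\<delta> - v) mod 6 = 0" "v \<noteq> 0" "ind v mod 6 = 3" using that by (auto simp: D_iff)
    qed
    have shift: "1 + v / (\<delta> - v) = \<delta> / (\<delta> - v)" if "v \<in> ?A" for v
      using A(1)[OF that] by (simp add: field_simps)
    show "\<forall>v\<in>?A. v / (\<delta> - v) * (\<delta> / (1 + v / (\<delta> - v))) = v"
      using A(1) shift \<delta> by simp
    show "(\<lambda>v. v / (\<delta> - v)) ` ?A \<subseteq> ?B"
    proof (intro image_subsetI)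
      fix v assume v: "v \<in> ?A"
      have "ind (v / (\<delta> - v)) mod 6 = 3" "ind (\<delta> / (\<delta> - v)) mod 6 = ind \<delta> mod 6"
        using div0[of v "\<delta> - v"] div0[OF \<delta>, of "\<delta> - v"] A[OF v] by auto
      thus "v / (\<delta> - v) \<in> ?B" using A[OF v] shift[OF v] by (auto simp: D_iff)
    qed
    have unshift: "\<delta> - v * (\<delta> / (1 + v)) = \<delta> / (1 + v)" if "v \<in> ?B" for v
      using that one_plus_D3_nonzero[of v] by (simp add: field_simps)
    show "\<forall>v\<in>?B. v * (\<delta> / (1 + v)) / (\<delta> - v * (\<delta> / (1 + v))) = v"
      using unshift one_plus_D3_nonzero \<delta> by auto
    show "(\<lambda>v. v * (\<delta> / (1 + v))) ` ?B \<subseteq> ?A"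
    proof (intro image_subsetI)
      fix v assume v: "v \<in> ?B"
      define u where "u = \<delta> / (1 + v)"
      have v1: "1 + v \<noteq> 0" "v \<noteq> 0" "ind v mod 6 = 3" "ind (1 + v) mod 6 = ind \<delta> mod 6"
        using v one_plus_D3_nonzero[of v] by (auto simp: D_iff)
      have u: "u \<noteq> 0" using v1 \<delta> by (simp add: u_def)
      have "(ind u + ind (1 + v)) mod 6 = ind (1 + v) mod 6"
        using ind_divide_mod[OF dvd_q_minus_1(1) \<delta> v1(1)] v1(4) by (simp add: u_def)
      hence "6 dvd (ind u + ind (1 + v)) - ind (1 + v)" using mod_eq_dvd_iff_nat by (metis le_add2)
      hence iu: "ind u mod 6 = 0" by simp
      hence "u \<in> D 0" using u by (simp add: D_iff)
      hence "- u \<in> D 0" by simp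
      moreover have "v * u - \<delta> = - u" using unshift[OF v] by (simp add: u_def algebra_simps)
      moreover have "v * u \<in> D 3"
        using ind_mult_cong[OF dvd_q_minus_1(1) v1(2) u iu] v1 u by (simp add: D_iff)
      ultimately show "v * (\<delta> / (1 + v)) \<in> ?A" by (simp add: u_def)
    qed
  qed
  thus ?thesis using card_D3_shifted[of "ind \<delta> mod 6"] by simp
qed

section \<open>The Cayley digraph\<close>

lemma gamma_power_sixfold_D0: "\<gamma> ^ (6 * k) \<in> D 0"
  by (auto simp: cyclo_class_def)

text \<open>As \<open>k\<close> runs below \<open>l\<close>, the powers run through
  \<open>D 0\<close> once each. For \<open>\<delta> = 0\<close> nothing is counted because
  \<open>D 0\<close> and \<open>D 3\<close> are disjoint.\<close>

lemma card_D3_translated_orbit: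
  "6 * card {k. k < l \<and> \<delta> + \<gamma> ^ (6 * k) \<in> D 3} = (if \<delta> = 0 then 0 else l)"
proof (cases "\<delta> = 0")
  case True
  have "\<gamma> ^ (6 * k) \<notin> D 3" for k
    using gamma_power_sixfold_D0[of k] by (simp add: D_iff)
  thus ?thesis using True by simp
next
  case False
  have inj: "inj_on (\<lambda>k. \<gamma> ^ (6 * k)) {k. k < l}"
    unfolding inj_on_def gamma_power_eq_iff q_minus_1 by simp
  have "card ((\<lambda>k. \<gamma> ^ (6 * k)) ` {k. k < l}) = l" using inj by (simp add: card_image)
  hence img: "(\<lambda>k. \<gamma> ^ (6 * k)) ` {k. k < l} = D 0"
    by (intro card_subset_eq) (auto simp: card_D gamma_power_sixfold_D0)
  have "bij_betw (\<lambda>k. \<delta> + \<gamma> ^ (6 * k)) {k. k < l \<and> \<delta> + \<gamma> ^ (6 * k) \<in> D 3} {v \<in> D 3. v - \<delta> \<in> D 0}"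
    unfolding bij_betw_def
  proof
    show "inj_on (\<lambda>k. \<delta> + \<gamma> ^ (6 * k)) {k. k < l \<and> \<delta> + \<gamma> ^ (6 * k) \<in> D 3}"
      using inj by (auto simp: inj_on_def)
    show "(\<lambda>k. \<delta> + \<gamma> ^ (6 * k)) ` {k. k < l \<and> \<delta> + \<gamma> ^ (6 * k) \<in> D 3} = {v \<in> D 3. v - \<delta> \<in> D 0}"
    proof (intro equalityI subsetI)
      fix v assume v: "v \<in> {v \<in> D 3. v - \<delta> \<in> D 0}"
      then obtain k where k: "k < l" "v - \<delta> = \<gamma> ^ (6 * k)" unfolding img[symmetric] by auto
      hence "v = \<delta> + \<gamma> ^ (6 * k)" by (simp add: algebra_simps)
      thus "v \<in> (\<lambda>k. \<delta> + \<gamma> ^ (6 * k)) ` {k. k < l \<and> \<delta> + \<gamma> ^ (6 * k) \<in> D 3}" using k v by auto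
    qed (auto simp: gamma_power_sixfold_D0)
  qed
  thus ?thesis using card_D3_minus_D0[OF False] False by (simp add: bij_betw_same_card)
qed

text \<open>Each \<open>w\<close> admits \<open>l / 6\<close> values of \<open>k\<close>, except
  \<open>w = \<delta>\<close>, which admits none and occurs only if \<open>\<delta>\<close> is in
  \<open>D 3\<close>.\<close>

lemma card_two_paths:
  "6 * card {(w, k). w \<in> D 3 \<and> k < l \<and> \<delta> - w + \<gamma> ^ (6 * k) \<in> D 3} = l * (l - of_bool (\<delta> \<in> D 3))"
proof -
  let ?K = "\<lambda>w. {k. k < l \<and> \<delta> - w + \<gamma> ^ (6 * k) \<in> D 3}"
  have "{(w, k). w \<in> D 3 \<and> k < l \<and> \<delta> - w + \<gamma> ^ (6 * k) \<in> D 3} = Sigma (D 3) ?K" by auto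
  hence "6 * card {(w, k). w \<in> D 3 \<and> k < l \<and> \<delta> - w + \<gamma> ^ (6 * k) \<in> D 3} = (\<Sum>w\<in>D 3. 6 * card (?K w))"
    by (simp add: sum_distrib_left)
  also have "\<dots> = (\<Sum>w\<in>D 3. if \<delta> - w = 0 then 0 else l)"
    by (simp only: card_D3_translated_orbit)
  also have "\<dots> = (\<Sum>w\<in>D 3 - {\<delta>}. l)"
    by (rule sum.mono_neutral_cong_right) auto
  also have "\<dots> = l * (l - of_bool (\<delta> \<in> D 3))"
    by (simp add: card_Diff_singleton_if card_D mult.commute)
  finally show ?thesis .
qed

text \<open>The first coordinate of the quotient is \<open>(y - x) / c\<close> with
  \<open>c = \<gamma> ^ (6 * i)\<close>; adding 1 and multiplying by \<open>c\<close>, an element of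
  \<open>D 0\<close>, gives the condition. The second coordinate is reduced modulo \<open>l\<close>
  and imposes none.\<close>

lemma cay_arc_iff:
  assumes i: "i < l"
  shows "cay_arc \<gamma> l {(x, i). x \<in> {- 1 + x | x. x \<in> D 3} \<and> i < l} (x, i) (y, j) \<longleftrightarrow>
    y - x + \<gamma> ^ (6 * i) \<in> D 3"
proof -
  define c where "c = \<gamma> ^ (6 * i)"
  have c0: "c \<noteq> 0" by (simp add: c_def)
  have "c * \<gamma> ^ (6 * ((l - i) mod l)) = \<gamma> ^ (6 * (i + (l - i) mod l))"
    by (simp add: c_def power_add algebra_simps)
  also have "6 * (i + (l - i) mod l) mod (q - 1) = 0 mod (q - 1)"
    unfolding q_minus_1 mult_mod_right[symmetric] using i by (simp add: mod_add_right_eq)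
  hence "\<gamma> ^ (6 * (i + (l - i) mod l)) = 1" using gamma_power_eq_iff[of _ 0] by simp
  finally have c_inv: "\<gamma> ^ (6 * ((l - i) mod l)) = inverse c" using c0 by (simp add: inverse_unique)
  have "cay_arc \<gamma> l {(x, i). x \<in> {- 1 + x | x. x \<in> D 3} \<and> i < l} (x, i) (y, j) \<longleftrightarrow>
      - inverse c * x + inverse c * y \<in> {- 1 + x | x. x \<in> D 3}"
    using l_pos by (simp add: cay_arc_def Gmult_def Ginv_def c_inv flip: c_def)
  also have "\<dots> \<longleftrightarrow> (y - x) / c + 1 \<in> D 3"
  proof -
    have shift: "- inverse c * x + inverse c * y = - 1 + ((y - x) / c + 1)" by (simp add: divide_inverse algebra_simps)
    have "- 1 + w \<in> {- 1 + x | x. x \<in> D 3} \<longleftrightarrow> w \<in> D 3" for w by auto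
    thus ?thesis unfolding shift .
  qed
  also have "\<dots> \<longleftrightarrow> ((y - x) / c + 1) * c \<in> D 3" unfolding c_def by simp
  also have "((y - x) / c + 1) * c = y - x + c" using c0 by (simp add: field_simps)
  finally show ?thesis by (simp add: c_def)
qed

text \<open>In terms of \<open>l\<close> the degree is \<open>l^2\<close>, the parameters
  \<open>t\<close> and \<open>mu\<close> are \<open>l^2 / 6\<close>, and \<open>lambda\<close> is
  \<open>l * (l - 1) / 6\<close>.\<close>

lemma dsrg_cay_arc:
  fixes E
  defines "E \<equiv> {(x, i). x \<in> {- 1 + x | x. x \<in> D 3} \<and> i < l}"
  shows "dsrg (Gcar l) (cay_arc \<gamma> l E) (real q * (real q - 1) / 6) (((real q - 1) / 6) ^ 2)
    ((real q - 1) ^ 2 / 216) ((real q - 1) ^ 2 / 216 - (real q - 1) / 36) ((real q - 1) ^ 2 / 216)"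
proof -
  have adj: "cay_arc \<gamma> l E (x, i) (y, j) \<longleftrightarrow> y - x + \<gamma> ^ (6 * i) \<in> D 3" if "i < l" for x y i j
    unfolding E_def by (rule cay_arc_iff[OF that])
  have V: "Gcar l = UNIV \<times> {..<l}" by (auto simp: Gcar_def)
  have rq: "real q - 1 = 6 * real l"
  proof -
    have "real q - 1 = real (q - 1)" using q_gt_1 by (simp add: of_nat_diff)
    thus ?thesis unfolding q_minus_1 by simp
  qed
  have no_loop: "\<gamma> ^ (6 * i) \<notin> D 3" for i
    using gamma_power_sixfold_D0[of i] by (simp add: D_iff)
  have out: "card {h \<in> Gcar l. cay_arc \<gamma> l E g h} = l * l" if g_in: "g \<in> Gcar l" for g
  proof -
    obtain x i where g: "g = (x, i)" "i < l" using g_in by (auto simp: Gcar_def)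
    have "bij_betw (\<lambda>(y, j). (y - x + \<gamma> ^ (6 * i), j)) {h \<in> Gcar l. cay_arc \<gamma> l E g h} (D 3 \<times> {..<l})"
      by (rule bij_betw_byWitness[where f' = "\<lambda>(w, j). (w + x - \<gamma> ^ (6 * i), j)"])
        (auto simp: V g adj)
    thus ?thesis by (simp add: bij_betw_same_card card_D)
  qed
  have "in": "card {h \<in> Gcar l. cay_arc \<gamma> l E h g} = l * l" if g_in: "g \<in> Gcar l" for g
  proof -
    obtain y j where g: "g = (y, j)" "j < l" using g_in by (auto simp: Gcar_def)
    have "bij_betw (\<lambda>(x, i). (y - x + \<gamma> ^ (6 * i), i)) {h \<in> Gcar l. cay_arc \<gamma> l E h g} (D 3 \<times> {..<l})"
      by (rule bij_betw_byWitness[where f' = "\<lambda>(w, i). (y + \<gamma> ^ (6 * i) - w, i)"])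
        (auto simp: V g adj)
    thus ?thesis by (simp add: bij_betw_same_card card_D)
  qed
  have paths: "6 * card {z \<in> Gcar l. cay_arc \<gamma> l E g z \<and> cay_arc \<gamma> l E z h}
      = l * (l - of_bool (cay_arc \<gamma> l E g h))" if "g \<in> Gcar l" "h \<in> Gcar l" for g h
  proof -
    obtain x i y j where gh: "g = (x, i)" "i < l" "h = (y, j)" "j < l"
      using \<open>g \<in> Gcar l\<close> \<open>h \<in> Gcar l\<close> by (auto simp: Gcar_def)
    \<comment> \<open>An arc from \<open>g\<close> to \<open>h\<close> means
      \<open>\<delta> \<in> D 3\<close>. If \<open>w\<close> is the corresponding element for the
      first arc, the second arc has \<open>\<delta> - w + \<gamma> ^ (6 * k)\<close>.\<close>
    define \<delta> where "\<delta> = y - x + \<gamma> ^ (6 * i)"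
    have "bij_betw (\<lambda>(z, k). (z - x + \<gamma> ^ (6 * i), k))
        {z \<in> Gcar l. cay_arc \<gamma> l E g z \<and> cay_arc \<gamma> l E z h}
        {(w, k). w \<in> D 3 \<and> k < l \<and> \<delta> - w + \<gamma> ^ (6 * k) \<in> D 3}"
      by (rule bij_betw_byWitness[where f' = "\<lambda>(w, k). (w + x - \<gamma> ^ (6 * i), k)"])
        (auto simp: V gh adj \<delta>_def algebra_simps)
    hence "card {z \<in> Gcar l. cay_arc \<gamma> l E g z \<and> cay_arc \<gamma> l E z h}
        = card {(w, k). w \<in> D 3 \<and> k < l \<and> \<delta> - w + \<gamma> ^ (6 * k) \<in> D 3}"
      by (rule bij_betw_same_card)
    thus ?thesis using card_two_paths[of \<delta>] gh by (simp add: adj \<delta>_def)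
  qed
  \<comment> \<open>Truncated subtraction agrees with the real one because
    \<open>l > 0\<close>.\<close>
  have l6: "real (6 * n) = real l * (real l - of_bool b)" if "6 * n = l * (l - of_bool b)" for n b
    unfolding that using l_pos by (cases b) (simp_all add: of_nat_diff)
  have "real (card {z \<in> Gcar l. cay_arc \<gamma> l E g z \<and> cay_arc \<gamma> l E z h}) =
      (if g = h then (6 * real l) ^ 2 / 216 else if cay_arc \<gamma> l E g h
       then (6 * real l) ^ 2 / 216 - 6 * real l / 36 else (6 * real l) ^ 2 / 216)"
    if "g \<in> Gcar l" "h \<in> Gcar l" for g h
  proof -
    have "\<not> cay_arc \<gamma> l E g g" using that(1) no_loop by (auto simp: Gcar_def adj)
    thus ?thesis using l6[OF paths[OF that]] by (auto simp: power2_eq_square field_simps)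
  qed
  moreover have "real (card (Gcar l :: ('a \<times> nat) set)) = real q * (6 * real l) / 6"
    by (simp add: V q_eq card_cartesian_product)
  moreover have "\<not> cay_arc \<gamma> l E g g" if "g \<in> Gcar l" for g
    using that no_loop by (auto simp: Gcar_def adj)
  moreover have "finite (Gcar l :: ('a \<times> nat) set)" by (simp add: V)
  ultimately show ?thesis unfolding dsrg_def rq by (simp add: out "in" power2_eq_square)
qed

end

theorem mainTheorem6:
  fixes \<gamma> :: "'a::{finite,field}" and a :: int and q l :: nat
    and S :: "'a set" and E :: "('a \<times> nat) set"
  assumes q_def: "q = card (UNIV :: 'a set)"
    and q_form: "int q = 1 + 3 * a ^ 2"
    and cubic: "\<exists>z::'a. z \<noteq> 0 \<and> 2 = z ^ 3"
    and prim: "primitive_elem \<gamma>"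
    and l_def: "l = (q - 1) div 6"
    and S_def: "S = {-1 + x | x. x \<in> cyclo_class \<gamma> 6 3}"
    and E_def: "E = {(x, i). x \<in> S \<and> i < l}"
  shows "dsrg (Gcar l) (cay_arc \<gamma> l E)
           (real q * (real q - 1) / 6)
           (((real q - 1) / 6) ^ 2)
           ((real q - 1) ^ 2 / 216)
           ((real q - 1) ^ 2 / 216 - (real q - 1) / 36)
           ((real q - 1) ^ 2 / 216)"
proof -
  interpret norm_form_field \<gamma> q a l
    using assms by unfold_locales
  show ?thesis
    unfolding E_def S_def by (rule dsrg_cay_arc)
qed

end
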